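(* Let $a>0$, $\alpha>0$ and let $V_+,V_-\in L^\infty(\mathbb{R})$ be non-negative. Assume there exist $x_1^0\in\mathbb{R}$ and positive numbers $V_0$ and $R$ such that for all $x_1\in(x_1^0-R,x_1^0+R)$ one has $V_+(x_1)\geq V_0$ or $V_-(x_1)\geq V_0$. Then $$H_{\alpha,V_+,V_-}-\xi_0\geq c\,\rho,\qquad \rho(x):=\frac{1}{1+(x_1-x_1^0)^2},$$ in the sense of quadratic forms (i.e. $\mathcal{E}_{\alpha,V_+,V_-}[\psi]-\xi_0\|\psi\|^2_{L^2(\mathbb{R}^2)}\geq c\int_{\mathbb{R}^2}\rho|\psi|^2$ for all $\psi\in W^{1,2}(\mathbb{R}^2)$), where $c>0$ is a constant depending on $V_0$, $R$ and $a$ (for the fixed $\alpha$).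
   Context: $H_{\alpha,V_+,V_-}$ is the self-adjoint operator in $L^2(\mathbb{R}^2)$ associated with the form $$\mathcal{E}_{\alpha,V_+,V_-}[\psi]=\int_{\mathbb{R}^2}|\nabla\psi|^2+\int_{\mathbb{R}}(V_+(x_1)-\alpha)|\psi(x_1,a)|^2\,dx_1+\int_{\mathbb{R}}(V_-(x_1)-\alpha)|\psi(x_1,-a)|^2\,dx_1,\qquad \psi\in W^{1,2}(\mathbb{R}^2)$$ (traces on $\mathbb{R}\times\{\pm a\}$). $\xi_0<0$ is the lowest eigenvalue of the operator $-\Delta_\alpha^{\mathbb{R}}$ in $L^2(\mathbb{R})$ associated with the form $\int_{\mathbb{R}}|\phi'|^2-\alpha|\phi(a)|^2-\alpha|\phi(-a)|^2$ on $W^{1,2}(\mathbb{R})$. *)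

theory Defs
  imports "HOL-Analysis.Analysis"
begin

text \<open>Sobolev space W^{1,2}(R): phi is the (unique) continuous, locally absolutely
continuous representative of its class, with weak derivative g; both in L^2.\<close>
definition W12_1d :: "(real \<Rightarrow> complex) \<Rightarrow> (real \<Rightarrow> complex) \<Rightarrow> bool" where
  "W12_1d \<phi> g \<longleftrightarrow>
     \<phi> \<in> borel_measurable lborel \<and> g \<in> borel_measurable lborel \<and>
     integrable lborel (\<lambda>t. (cmod (\<phi> t))\<^sup>2) \<and> integrable lborel (\<lambda>t. (cmod (g t))\<^sup>2) \<and>
     (\<forall>s t. s \<le> t \<longrightarrow> set_integrable lborel {s..t} g \<and>
              \<phi> t - \<phi> s = (LINT u:{s..t}|lborel. g u))"

text \<open>Sobolev space W^{1,2}(R^2) (ACL characterisation): psi is a representative that is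
locally absolutely continuous on almost every line parallel to the coordinate axes, with
partial derivatives g1, g2; psi, g1, g2 in L^2(R^2). The trace of psi on R x {b} is then
x1 \<mapsto> psi (x1, b) (well defined for a.e. x1).\<close>
definition W12_2d :: "(real \<times> real \<Rightarrow> complex) \<Rightarrow> (real \<times> real \<Rightarrow> complex)
                      \<Rightarrow> (real \<times> real \<Rightarrow> complex) \<Rightarrow> bool" where
  "W12_2d \<psi> g1 g2 \<longleftrightarrow>
     \<psi> \<in> borel_measurable lborel \<and> g1 \<in> borel_measurable lborel \<and> g2 \<in> borel_measurable lborel \<and>
     integrable lborel (\<lambda>x. (cmod (\<psi> x))\<^sup>2) \<and>
     integrable lborel (\<lambda>x. (cmod (g1 x))\<^sup>2) \<and>
     integrable lborel (\<lambda>x. (cmod (g2 x))\<^sup>2) \<and>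
     (AE x2 in lborel. \<forall>s t. s \<le> t \<longrightarrow> set_integrable lborel {s..t} (\<lambda>u. g1 (u, x2)) \<and>
              \<psi> (t, x2) - \<psi> (s, x2) = (LINT u:{s..t}|lborel. g1 (u, x2))) \<and>
     (AE x1 in lborel. \<forall>s t. s \<le> t \<longrightarrow> set_integrable lborel {s..t} (\<lambda>u. g2 (x1, u)) \<and>
              \<psi> (x1, t) - \<psi> (x1, s) = (LINT u:{s..t}|lborel. g2 (x1, u)))"

text \<open>Eigenvalues of the operator -Delta_alpha^R associated with the closed form
  int phi' conj eta' - alpha phi(a) conj eta(a) - alpha phi(-a) conj eta(-a) on W^{1,2}(R):
  phi is in the operator domain with H phi = xi phi iff the form identity holds for all
  eta in the form domain.\<close>
definition is_eigenvalue_1d :: "real \<Rightarrow> real \<Rightarrow> real \<Rightarrow> bool" where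
  "is_eigenvalue_1d \<alpha> a \<xi> \<longleftrightarrow>
     (\<exists>\<phi> g. W12_1d \<phi> g \<and> (\<exists>t. \<phi> t \<noteq> 0) \<and>
        (\<forall>\<eta> h. W12_1d \<eta> h \<longrightarrow>
           (LINT t|lborel. g t * cnj (h t))
             - of_real \<alpha> * \<phi> a * cnj (\<eta> a) - of_real \<alpha> * \<phi> (-a) * cnj (\<eta> (-a))
           = of_real \<xi> * (LINT t|lborel. \<phi> t * cnj (\<eta> t))))"

definition xi0 :: "real \<Rightarrow> real \<Rightarrow> real" where
  "xi0 \<alpha> a = Inf {\<xi>. is_eigenvalue_1d \<alpha> a \<xi>}"

definition form_E :: "real \<Rightarrow> real \<Rightarrow> (real \<Rightarrow> real) \<Rightarrow> (real \<Rightarrow> real)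
     \<Rightarrow> (real \<times> real \<Rightarrow> complex) \<Rightarrow> (real \<times> real \<Rightarrow> complex) \<Rightarrow> (real \<times> real \<Rightarrow> complex) \<Rightarrow> real" where
  "form_E \<alpha> a Vp Vm \<psi> g1 g2 =
     (LINT x|lborel. (cmod (g1 x))\<^sup>2 + (cmod (g2 x))\<^sup>2)
     + (LINT x1|lborel. (Vp x1 - \<alpha>) * (cmod (\<psi> (x1, a)))\<^sup>2)
     + (LINT x1|lborel. (Vm x1 - \<alpha>) * (cmod (\<psi> (x1, -a)))\<^sup>2)"

end

theory Submission
  imports Defs
begin

text \<open>
  Every lower bound comes from integrating the derivative of \<open>w |\<phi>|\<^sup>2\<close> for a weight with
  \<open>w' + w\<^sup>2 \<le> q\<close>, which yields \<open>w |\<phi>|\<^sup>2\<close> at the endpoints as a lower bound of \<open>\<integral> |\<phi>'|\<^sup>2 + q |\<phi>|\<^sup>2\<close>.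
  On the vertical fibres, tanh-weights (\<open>q = \<kappa>\<^sup>2\<close>) give a sharp bound for the double delta
  interaction, so that \<open>\<xi>\<^sub>0 \<le> -k\<^sup>2\<close> where \<open>k (1 + tanh (k a)) = \<alpha>\<close>, the eigenfunction being
  \<open>exp (-k |t - a|) + exp (-k |t + a|)\<close>. On the fibres over the interval where one of the potentials is at
  least \<open>V\<^sub>0\<close>, shifting the tanh-weight produces a spectral gap \<open>\<mu> = k\<^sup>2 - \<kappa>\<^sup>2 > 0\<close>.
  On the horizontal fibres, \<open>\<integral> |u'|\<^sup>2\<close> plus \<open>\<mu>\<close> times the integral of \<open>|u|\<^sup>2\<close> over this interval dominates the
  Hardy weight, by the choice \<open>w = d x / (r\<^sup>2 + x\<^sup>2)\<close>. Fubini's theorem combines the two.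
\<close>

subsection \<open>Absolutely continuous functions\<close>

text \<open>Isolates the absolute continuity clause shared by \<open>W12_1d\<close> and by the
  sections in \<open>W12_2d\<close>. The general codomain covers real weights and complex functions
  alike.\<close>

definition primitive :: "(real \<Rightarrow> 'a::{banach,second_countable_topology}) \<Rightarrow> (real \<Rightarrow> 'a) \<Rightarrow> bool" where
  "primitive F f \<longleftrightarrow>
     (\<forall>s t. s \<le> t \<longrightarrow> set_integrable lborel {s..t} f \<and> F t - F s = (LINT u:{s..t}|lborel. f u))"

lemma primitive_set_integrable: "primitive F f \<Longrightarrow> set_integrable lborel {s..t} f"
  by (cases "s \<le> t") (auto simp: primitive_def)

lemma primitive_diff: "primitive F f \<Longrightarrow> s \<le> t \<Longrightarrow> F t - F s = (LINT u:{s..t}|lborel. f u)"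
  by (auto simp: primitive_def)

lemma primitive_continuous_on:
  fixes F :: "real \<Rightarrow> 'a::euclidean_space"
  assumes "primitive F f"
  shows "continuous_on {s..t} F"
proof -
  have si: "set_integrable lborel {s..t} f"
    using assms by (rule primitive_set_integrable)
  have "continuous_on {s..t} (\<lambda>x. integral {s..x} f)"
    by (rule indefinite_integral_continuous_1) (rule set_borel_integral_eq_integral[OF si])
  then have "continuous_on {s..t} (\<lambda>x. F s + integral {s..x} f)"
    by (intro continuous_intros)
  moreover have "F x = F s + integral {s..x} f" if "x \<in> {s..t}" for x
  proof -
    have "F x - F s = (LINT u:{s..x}|lborel. f u)"
      using primitive_diff[OF assms] that by auto
    also have "\<dots> = integral {s..x} f"
      by (rule set_borel_integral_eq_integral(2)[OF primitive_set_integrable[OF assms]])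
    finally show ?thesis by (simp add: algebra_simps)
  qed
  ultimately show ?thesis
    by (metis (no_types, lifting) continuous_on_eq)
qed

text \<open>A continuous \<open>G\<close> is bounded on the compact interval, so the product is
  dominated by a multiple of \<open>f\<close>. All measurability is shown after cutting off with the
  indicator, because \<open>f\<close> is only controlled on \<open>{s..t}\<close>.\<close>

lemma set_integrable_mult_continuous:
  fixes f G :: "real \<Rightarrow> 'a::{euclidean_space,real_normed_field}"
  assumes f: "set_integrable lborel {s..t} f" and G: "continuous_on {s..t} G"
  shows "set_integrable lborel {s..t} (\<lambda>u. f u * G u)"
proof -
  have "compact (G ` {s..t})"
    by (intro compact_continuous_image G compact_Icc)
  then obtain B where B: "\<And>u. u \<in> {s..t} \<Longrightarrow> norm (G u) \<le> B"
    by (meson bounded_iff compact_imp_bounded imageI)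
  have GM: "(\<lambda>u. indicator {s..t} u *\<^sub>R G u) \<in> borel_measurable lborel"
    using borel_measurable_continuous_on_indicator[OF _ G] by simp
  have fM: "(\<lambda>u. indicator {s..t} u *\<^sub>R f u) \<in> borel_measurable lborel"
    using f by (auto simp: set_integrable_def)
  have "(\<lambda>u. (indicator {s..t} u *\<^sub>R f u) * (indicator {s..t} u *\<^sub>R G u)) \<in> borel_measurable lborel"
    using fM GM by (rule borel_measurable_times)
  also have "(\<lambda>u. (indicator {s..t} u *\<^sub>R f u) * (indicator {s..t} u *\<^sub>R G u)) =
      (\<lambda>u. indicator {s..t} u *\<^sub>R (f u * G u))"
    by (auto simp: fun_eq_iff indicator_def)
  finally have m: "(\<lambda>u. indicator {s..t} u *\<^sub>R (f u * G u)) \<in> borel_measurable lborel" .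
  have i: "integrable lborel (\<lambda>u. B *\<^sub>R (indicator {s..t} u *\<^sub>R f u))"
    using f unfolding set_integrable_def by (rule integrable_scaleR_right)
  show ?thesis
    unfolding set_integrable_def
  proof (rule Bochner_Integration.integrable_bound[OF i m], rule AE_I2)
    fix u
    show "norm (indicator {s..t} u *\<^sub>R (f u * G u)) \<le> norm (B *\<^sub>R (indicator {s..t} u *\<^sub>R f u))"
    proof (cases "u \<in> {s..t}")
      case True
      then have "norm (f u) * norm (G u) \<le> norm (f u) * \<bar>B\<bar>"
        using B[of u] by (intro mult_left_mono) auto
      then show ?thesis using True by (simp add: norm_mult mult.commute)
    qed simp
  qed
qed

text \<open>Integrate \<open>f u * g v\<close> over the square \<open>[s,t]\<^sup>2\<close> and split it along the diagonal.\<close>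
lemma primitive_mult:
  fixes F G :: "real \<Rightarrow> 'a::{euclidean_space,real_normed_field}"
  assumes F: "primitive F f" and G: "primitive G g"
  shows "primitive (\<lambda>x. F x * G x) (\<lambda>x. f x * G x + F x * g x)"
  unfolding primitive_def
proof (intro allI impI conjI)
  fix s t :: real
  assume st: "s \<le> t"
  have fi: "set_integrable lborel {s..t} f" and gi: "set_integrable lborel {s..t} g"
    using F G by (auto intro: primitive_set_integrable)
  have i1: "set_integrable lborel {s..t} (\<lambda>x. f x * G x)"
    using fi G by (intro set_integrable_mult_continuous primitive_continuous_on)
  have i2: "set_integrable lborel {s..t} (\<lambda>x. F x * g x)"
    using set_integrable_mult_continuous[OF gi primitive_continuous_on[OF F]] by (simp add: mult.commute)
  show "set_integrable lborel {s..t} (\<lambda>x. f x * G x + F x * g x)"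
    using i1 i2 by (rule set_integral_add)
  \<comment> \<open>Extension by zero turns the integrals over the square into integrals over the
    plane, where Fubini applies.\<close>
  define f' where "f' = (\<lambda>u. indicator {s..t} u *\<^sub>R f u)"
  define g' where "g' = (\<lambda>u. indicator {s..t} u *\<^sub>R g u)"
  have f'i: "integrable lborel f'" and g'i: "integrable lborel g'"
    using fi gi by (auto simp: f'_def g'_def set_integrable_def)
  have [measurable]: "f' \<in> borel_measurable borel" "g' \<in> borel_measurable borel"
    using f'i g'i by auto
  have dF: "F t - F s = (LINT u|lborel. f' u)" and dG: "G t - G s = (LINT u|lborel. g' u)"
    using primitive_diff[OF F st] primitive_diff[OF G st]
    by (auto simp: f'_def g'_def set_lebesgue_integral_def)
  have Gu: "(LINT v|lborel. indicator {..u} v *\<^sub>R g' v) = G u - G s" if "u \<in> {s..t}" for u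
  proof -
    have "(LINT v|lborel. indicator {..u} v *\<^sub>R g' v) = (LINT v:{s..u}|lborel. g v)"
      unfolding set_lebesgue_integral_def using that
      by (intro Bochner_Integration.integral_cong) (auto simp: g'_def indicator_def)
    then show ?thesis using primitive_diff[OF G, of s u] that by auto
  qed
  \<comment> \<open>The half-line is open here and closed in \<open>Gu\<close>, so that the
    triangles \<open>v \<le> u\<close> and \<open>u < v\<close> are complementary and the diagonal
    is counted once. The missing endpoint is a null set.\<close>
  have Fv: "(LINT u|lborel. indicator {..<v} u *\<^sub>R f' u) = F v - F s" if "v \<in> {s..t}" for v
  proof -
    have "AE u in lborel. u \<noteq> v" by (rule AE_lborel_singleton)
    then have "(LINT u|lborel. indicator {..<v} u *\<^sub>R f' u) = (LINT u:{s..v}|lborel. f u)"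
      unfolding set_lebesgue_integral_def
    proof (intro integral_cong_AE)
      show "(\<lambda>u. indicator {s..v} u *\<^sub>R f u) \<in> borel_measurable lborel"
        using primitive_set_integrable[OF F, of s v] by (auto simp: set_integrable_def)
      show "(\<lambda>u. indicator {..<v} u *\<^sub>R f' u) \<in> borel_measurable lborel"
        by measurable
    qed (use that in \<open>auto elim!: eventually_mono simp: f'_def indicator_def\<close>)
    then show ?thesis using primitive_diff[OF F, of s v] that by auto
  qed
  have H0: "integrable (lborel \<Otimes>\<^sub>M lborel) (\<lambda>p. f' (fst p) * g' (snd p))"
  proof (rule lborel_pair.Fubini_integrable)
    show "(\<lambda>p. f' (fst p) * g' (snd p)) \<in> borel_measurable (lborel \<Otimes>\<^sub>M lborel)"
      by measurable
    show "integrable lborel (\<lambda>x. LINT y|lborel. norm (f' (fst (x, y)) * g' (snd (x, y))))"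
      using f'i by (simp add: norm_mult)
    show "AE x in lborel. integrable lborel (\<lambda>y. f' (fst (x, y)) * g' (snd (x, y)))"
      using g'i by simp
  qed
  have H: "integrable (lborel \<Otimes>\<^sub>M lborel) (\<lambda>(u, v). f' u * (indicator {u<..} v *\<^sub>R g' v))"
  proof (rule Bochner_Integration.integrable_bound[OF H0])
    have "(\<lambda>p. indicator {p :: real \<times> real. fst p < snd p} p *\<^sub>R (f' (fst p) * g' (snd p)))
        \<in> borel_measurable (lborel \<Otimes>\<^sub>M lborel)"
      by measurable
    then show "(\<lambda>(u, v). f' u * (indicator {u<..} v *\<^sub>R g' v)) \<in> borel_measurable (lborel \<Otimes>\<^sub>M lborel)"
      by (rule back_subst[of "\<lambda>h. h \<in> _"]) (auto simp: fun_eq_iff indicator_def)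
  qed (auto simp: indicator_def norm_mult)
  \<comment> \<open>Over the triangle \<open>u < v\<close> the order of integration is exchanged, so
    that the inner integral becomes an increment of \<open>F\<close>.\<close>
  have swap: "(LINT u|lborel. f' u * (LINT v|lborel. indicator {u<..} v *\<^sub>R g' v)) =
      (LINT v|lborel. (LINT u|lborel. indicator {..<v} u *\<^sub>R f' u) * g' v)"
  proof -
    have "(LINT u|lborel. f' u * (LINT v|lborel. indicator {u<..} v *\<^sub>R g' v)) =
        (LINT u|lborel. LINT v|lborel. f' u * (indicator {u<..} v *\<^sub>R g' v))"
      by (simp only: integral_mult_right_zero)
    also have "\<dots> = (LINT v|lborel. LINT u|lborel. f' u * (indicator {u<..} v *\<^sub>R g' v))"
      by (rule lborel_pair.Fubini_integral[OF H, symmetric])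
    also have "(\<lambda>v u. f' u * (indicator {u<..} v *\<^sub>R g' v)) =
        (\<lambda>v u. (indicator {..<v} u *\<^sub>R f' u) * g' v)"
      by (auto simp: fun_eq_iff indicator_def)
    also have "(LINT v|lborel. LINT u|lborel. (indicator {..<v} u *\<^sub>R f' u) * g' v) =
        (LINT v|lborel. (LINT u|lborel. indicator {..<v} u *\<^sub>R f' u) * g' v)"
      by (simp only: integral_mult_left_zero)
    finally show ?thesis .
  qed
  have gsplit: "(LINT v|lborel. g' v) = (LINT v|lborel. indicator {..u} v *\<^sub>R g' v)
      + (LINT v|lborel. indicator {u<..} v *\<^sub>R g' v)" for u
  proof -
    have "(LINT v|lborel. g' v) =
        (LINT v|lborel. indicator {..u} v *\<^sub>R g' v + indicator {u<..} v *\<^sub>R g' v)"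
      by (intro Bochner_Integration.integral_cong) (auto simp: indicator_def)
    also have "\<dots> = (LINT v|lborel. indicator {..u} v *\<^sub>R g' v) + (LINT v|lborel. indicator {u<..} v *\<^sub>R g' v)"
      using g'i by (intro Bochner_Integration.integral_add integrable_mult_indicator) auto
    finally show ?thesis .
  qed
  have e1: "(\<lambda>u. f' u * (LINT v|lborel. indicator {..u} v *\<^sub>R g' v))
      = (\<lambda>u. indicator {s..t} u *\<^sub>R (f u * G u) - f' u * G s)"
  proof
    fix u
    show "f' u * (LINT v|lborel. indicator {..u} v *\<^sub>R g' v)
      = indicator {s..t} u *\<^sub>R (f u * G u) - f' u * G s"
      by (cases "u \<in> {s..t}") (simp_all only: f'_def Gu right_diff_distrib, simp_all)
  qed
  have j1: "integrable lborel (\<lambda>u. indicator {s..t} u *\<^sub>R (f u * G u))"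
    and j2: "integrable lborel (\<lambda>u. indicator {s..t} u *\<^sub>R (F u * g u))"
    using i1 i2 by (auto simp: set_integrable_def)
  have k1: "integrable lborel (\<lambda>u. f' u * (LINT v|lborel. indicator {..u} v *\<^sub>R g' v))"
    unfolding e1 using f'i j1 by auto
  have e2: "f' u * (LINT v|lborel. indicator {u<..} v *\<^sub>R g' v)
     = f' u * (G t - G s) - f' u * (LINT v|lborel. indicator {..u} v *\<^sub>R g' v)" for u
    using gsplit[of u] dG by (simp add: algebra_simps)
  have k2: "integrable lborel (\<lambda>u. f' u * (LINT v|lborel. indicator {u<..} v *\<^sub>R g' v))"
    unfolding e2 using f'i k1 by auto
  have "(F t - F s) * (G t - G s) = (LINT u|lborel. f' u * (G t - G s))"
    using dF by simp
  also have "\<dots> = (LINT u|lborel. f' u * (LINT v|lborel. indicator {..u} v *\<^sub>R g' v)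
      + f' u * (LINT v|lborel. indicator {u<..} v *\<^sub>R g' v))"
    by (simp add: e2)
  also have "\<dots> = (LINT u|lborel. f' u * (LINT v|lborel. indicator {..u} v *\<^sub>R g' v))
      + (LINT u|lborel. f' u * (LINT v|lborel. indicator {u<..} v *\<^sub>R g' v))"
    using k1 k2 by (rule Bochner_Integration.integral_add)
  also have "(LINT u|lborel. f' u * (LINT v|lborel. indicator {..u} v *\<^sub>R g' v))
      = (LINT u:{s..t}|lborel. f u * G u) - (F t - F s) * G s"
    unfolding e1 using f'i j1 dF by (simp add: set_lebesgue_integral_def)
  also have "(LINT u|lborel. f' u * (LINT v|lborel. indicator {u<..} v *\<^sub>R g' v))
      = (LINT u:{s..t}|lborel. F u * g u) - F s * (G t - G s)"
  proof -
    have "(\<lambda>v. (LINT u|lborel. indicator {..<v} u *\<^sub>R f' u) * g' v)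
      = (\<lambda>u. indicator {s..t} u *\<^sub>R (F u * g u) - F s * g' u)"
    proof
      fix v
      show "(LINT u|lborel. indicator {..<v} u *\<^sub>R f' u) * g' v
        = indicator {s..t} v *\<^sub>R (F v * g v) - F s * g' v"
        by (cases "v \<in> {s..t}") (simp_all only: g'_def Fv left_diff_distrib, simp_all)
    qed
    then show ?thesis
      unfolding swap using g'i j2 dG by (simp add: set_lebesgue_integral_def)
  qed
  finally have "F t * G t - F s * G s = (LINT u:{s..t}|lborel. f u * G u) + (LINT u:{s..t}|lborel. F u * g u)"
    by (simp add: algebra_simps)
  also have "\<dots> = (LINT u:{s..t}|lborel. f u * G u + F u * g u)"
    using i1 i2 by (rule set_integral_add(2)[symmetric])
  finally show "F t * G t - F s * G s = (LINT u:{s..t}|lborel. f u * G u + F u * g u)" .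
qed

text \<open>Brings smooth weights and exponentials under the product rule
  \<open>primitive_mult\<close>.\<close>

lemma primitive_continuous_derivative:
  fixes F :: "real \<Rightarrow> 'a::euclidean_space"
  assumes D: "\<And>x. (F has_vector_derivative f x) (at x)" and c: "continuous_on UNIV f"
  shows "primitive F f"
  unfolding primitive_def
proof (intro allI impI conjI)
  fix s t :: real
  assume st: "s \<le> t"
  have cst: "continuous_on {s..t} f" using c continuous_on_subset by blast
  show si: "set_integrable lborel {s..t} f"
    using borel_integrable_atLeastAtMost'[OF cst] .
  have "(f has_integral F t - F s) {s..t}"
    by (rule fundamental_theorem_of_calculus[OF st]) (auto intro: D has_vector_derivative_at_within)
  then show "F t - F s = (LINT u:{s..t}|lborel. f u)"
    using set_borel_integral_eq_integral(2)[OF si] integral_unique by metis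
qed

subsection \<open>Lower bounds on intervals\<close>

text \<open>Applied with \<open>Re\<close>, \<open>cnj\<close> and \<open>of_real\<close>, to move
  between real and complex functions.\<close>

lemma primitive_bounded_linear:
  assumes "bounded_linear T" "primitive F f"
  shows "primitive (\<lambda>x. T (F x)) (\<lambda>x. T (f x))"
  unfolding primitive_def
proof (intro allI impI conjI)
  interpret bounded_linear T by fact
  fix s t :: real
  assume st: "s \<le> t"
  have si: "set_integrable lborel {s..t} f"
    using assms(2) by (rule primitive_set_integrable)
  then have i: "integrable lborel (\<lambda>x. indicator {s..t} x *\<^sub>R f x)"
    by (simp add: set_integrable_def)
  show "set_integrable lborel {s..t} (\<lambda>x. T (f x))"
    using integrable_bounded_linear[OF assms(1) i] by (simp add: set_integrable_def scaleR)
  have "T (F t) - T (F s) = T (LINT u:{s..t}|lborel. f u)"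
    using primitive_diff[OF assms(2) st] by (simp flip: diff)
  also have "\<dots> = (LINT u:{s..t}|lborel. T (f u))"
    using integral_bounded_linear[OF assms(1) i] by (simp add: set_lebesgue_integral_def scaleR)
  finally show "T (F t) - T (F s) = (LINT u:{s..t}|lborel. T (f u))" .
qed

text \<open>The derivative of \<open>w |\<phi>|\<^sup>2\<close> is \<open>w' |\<phi>|\<^sup>2 + 2 w Re (g \<phi>\<^sup>*)\<close>, and the cross term is at most
  \<open>w\<^sup>2 |\<phi>|\<^sup>2 + |g|\<^sup>2\<close>.\<close>
lemma riccati_weight_bound:
  fixes \<phi> g :: "real \<Rightarrow> complex" and w w' q :: "real \<Rightarrow> real"
  assumes \<phi>: "primitive \<phi> g"
    and w: "\<And>x. (w has_real_derivative w' x) (at x)" and w': "continuous_on UNIV w'"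
    and si: "set_integrable lborel {s..t} (\<lambda>x. (cmod (g x))\<^sup>2 + q x * (cmod (\<phi> x))\<^sup>2)"
    and q: "\<And>x. x \<in> {s..t} \<Longrightarrow> w' x + (w x)\<^sup>2 \<le> q x" and st: "s \<le> t"
  shows "w t * (cmod (\<phi> t))\<^sup>2 - w s * (cmod (\<phi> s))\<^sup>2
    \<le> (LINT x:{s..t}|lborel. (cmod (g x))\<^sup>2 + q x * (cmod (\<phi> x))\<^sup>2)"
proof -
  have pw: "primitive (\<lambda>x. complex_of_real (w x)) (\<lambda>x. of_real (w' x))"
    using w w' by (intro primitive_continuous_derivative continuous_intros)
      (auto intro!: has_vector_derivative_of_real simp: has_real_derivative_iff_has_vector_derivative)
  have pc: "primitive (\<lambda>x. cnj (\<phi> x)) (\<lambda>x. cnj (g x))"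
    using bounded_linear_cnj \<phi> by (rule primitive_bounded_linear)
  define f where "f = (\<lambda>x. w' x * (cmod (\<phi> x))\<^sup>2 + 2 * w x * Re (g x * cnj (\<phi> x)))"
  \<comment> \<open>The product rule is used in the complex numbers, where the squared modulus is
    \<open>\<phi> x * cnj (\<phi> x)\<close>; the real part is taken at the end.\<close>
  have "primitive (\<lambda>x. Re (of_real (w x) * (\<phi> x * cnj (\<phi> x))))
      (\<lambda>x. Re (of_real (w' x) * (\<phi> x * cnj (\<phi> x)) + of_real (w x) * (g x * cnj (\<phi> x) + \<phi> x * cnj (g x))))"
    by (intro primitive_bounded_linear[OF bounded_linear_Re] primitive_mult pw \<phi> pc)
  also have "(\<lambda>x. Re (of_real (w x) * (\<phi> x * cnj (\<phi> x)))) = (\<lambda>x. w x * (cmod (\<phi> x))\<^sup>2)"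
    unfolding cmod_power2 by (simp add: power2_eq_square fun_eq_iff)
  also have "(\<lambda>x. Re (of_real (w' x) * (\<phi> x * cnj (\<phi> x)) + of_real (w x) * (g x * cnj (\<phi> x) + \<phi> x * cnj (g x)))) = f"
    unfolding f_def cmod_power2 by (simp add: power2_eq_square fun_eq_iff algebra_simps)
  finally have p: "primitive (\<lambda>x. w x * (cmod (\<phi> x))\<^sup>2) f" .
  have "f x \<le> (cmod (g x))\<^sup>2 + q x * (cmod (\<phi> x))\<^sup>2" if "x \<in> {s..t}" for x
  proof -
    have "0 \<le> (cmod (g x - of_real (w x) * \<phi> x))\<^sup>2" by simp
    also have "\<dots> = (cmod (g x))\<^sup>2 + (w x)\<^sup>2 * (cmod (\<phi> x))\<^sup>2 - 2 * w x * Re (g x * cnj (\<phi> x))"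
      unfolding cmod_power2 by (simp add: power2_eq_square algebra_simps)
    finally have "f x \<le> (cmod (g x))\<^sup>2 + (w' x + (w x)\<^sup>2) * (cmod (\<phi> x))\<^sup>2"
      by (simp add: f_def algebra_simps)
    also have "\<dots> \<le> (cmod (g x))\<^sup>2 + q x * (cmod (\<phi> x))\<^sup>2"
      using q[OF that] by (intro add_left_mono mult_right_mono) auto
    finally show ?thesis .
  qed
  then have "(LINT x:{s..t}|lborel. f x) \<le> (LINT x:{s..t}|lborel. (cmod (g x))\<^sup>2 + q x * (cmod (\<phi> x))\<^sup>2)"
    by (intro set_integral_mono primitive_set_integrable[OF p] si)
  then show ?thesis using primitive_diff[OF p st] by simp
qed

section \<open>Hyperbolic tangent weights and the sharp bound at two points\<close>

text \<open>The weight \<open>\<kappa> * tanh (\<kappa> * (x - b))\<close> solves the Riccati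
  equation \<open>w' + w\<^sup>2 = \<kappa>\<^sup>2\<close> exactly, for every position
  \<open>b\<close> of its zero.\<close>

lemma tanh_weight_bound:
  fixes \<phi> g :: "real \<Rightarrow> complex"
  assumes \<phi>: "primitive \<phi> g"
    and si: "integrable lborel (\<lambda>x. (cmod (g x))\<^sup>2 + \<kappa>\<^sup>2 * (cmod (\<phi> x))\<^sup>2)" and st: "s \<le> t"
  shows "\<kappa> * tanh (\<kappa> * (t - b)) * (cmod (\<phi> t))\<^sup>2 - \<kappa> * tanh (\<kappa> * (s - b)) * (cmod (\<phi> s))\<^sup>2
    \<le> (LINT x:{s..t}|lborel. (cmod (g x))\<^sup>2 + \<kappa>\<^sup>2 * (cmod (\<phi> x))\<^sup>2)"
proof (rule riccati_weight_bound[where q = "\<lambda>_. \<kappa>\<^sup>2" and w = "\<lambda>x. \<kappa> * tanh (\<kappa> * (x - b))"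
      and w' = "\<lambda>x. \<kappa>\<^sup>2 * (1 - (tanh (\<kappa> * (x - b)))\<^sup>2)"])
  show "((\<lambda>x. \<kappa> * tanh (\<kappa> * (x - b))) has_real_derivative \<kappa>\<^sup>2 * (1 - (tanh (\<kappa> * (x - b)))\<^sup>2)) (at x)" for x
    by (auto intro!: derivative_eq_intros simp: power2_eq_square algebra_simps)
  show "continuous_on UNIV (\<lambda>x. \<kappa>\<^sup>2 * (1 - (tanh (\<kappa> * (x - b)))\<^sup>2))"
    by (intro continuous_intros) auto
  show "set_integrable lborel {s..t} (\<lambda>x. (cmod (g x))\<^sup>2 + \<kappa>\<^sup>2 * (cmod (\<phi> x))\<^sup>2)"
    unfolding set_integrable_def using si by (intro integrable_mult_indicator) auto
qed (auto simp: \<phi> st power_mult_distrib algebra_simps)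

lemma tanh_tendsto_at_top:
  assumes "\<kappa> > 0"
  shows "((\<lambda>T. tanh (\<kappa> * (T + c))) \<longlongrightarrow> (1::real)) at_top"
proof (rule filterlim_compose[OF tanh_real_at_top])
  show "filterlim (\<lambda>T. \<kappa> * (T + c)) at_top at_top"
    using assms
    by (intro filterlim_tendsto_pos_mult_at_top[OF tendsto_const])
      (auto simp: add.commute[of _ c] intro!: filterlim_tendsto_add_at_top[OF tendsto_const] filterlim_ident)
qed

text \<open>Three tanh-weights are used on \<open>{-T..p}\<close>, \<open>{p..r}\<close> and
  \<open>{r..T}\<close>, with zeros at \<open>-T\<close>, \<open>b\<close> and \<open>T\<close>. The
  outer weights vanish at the far ends, so no boundary term appears there, and their values at
  \<open>p\<close> and \<open>r\<close> tend to \<kappa> in modulus as \<open>T\<close>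
  grows.\<close>

lemma two_point_bound:
  fixes \<phi> g :: "real \<Rightarrow> complex"
  assumes \<phi>: "primitive \<phi> g" and \<kappa>: "\<kappa> > 0" and pr: "p \<le> r"
    and si: "integrable lborel (\<lambda>x. (cmod (g x))\<^sup>2 + \<kappa>\<^sup>2 * (cmod (\<phi> x))\<^sup>2)"
  shows "\<kappa> * (1 + tanh (\<kappa> * (r - b))) * (cmod (\<phi> r))\<^sup>2 + \<kappa> * (1 - tanh (\<kappa> * (p - b))) * (cmod (\<phi> p))\<^sup>2
    \<le> (LINT x|lborel. (cmod (g x))\<^sup>2 + \<kappa>\<^sup>2 * (cmod (\<phi> x))\<^sup>2)" (is "?L \<le> integral\<^sup>L _ ?F")
proof -
  have le: "\<kappa> * (tanh (\<kappa> * (T + - r)) + tanh (\<kappa> * (r - b))) * (cmod (\<phi> r))\<^sup>2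
      + \<kappa> * (tanh (\<kappa> * (T + p)) - tanh (\<kappa> * (p - b))) * (cmod (\<phi> p))\<^sup>2 \<le> integral\<^sup>L lborel ?F"
    if T: "T \<ge> max (\<bar>p\<bar>) (\<bar>r\<bar>)" for T
  proof -
    have ii: "set_integrable lborel A ?F" if "A \<in> sets lborel" for A
      unfolding set_integrable_def using si that by (rule integrable_mult_indicator[rotated])
    have "\<kappa> * tanh (\<kappa> * (p - - T)) * (cmod (\<phi> p))\<^sup>2 - \<kappa> * tanh (\<kappa> * (- T - - T)) * (cmod (\<phi> (- T)))\<^sup>2
        \<le> (LINT x:{-T..p}|lborel. ?F x)"
      using T by (intro tanh_weight_bound \<phi> si) auto
    moreover have "\<kappa> * tanh (\<kappa> * (r - b)) * (cmod (\<phi> r))\<^sup>2 - \<kappa> * tanh (\<kappa> * (p - b)) * (cmod (\<phi> p))\<^sup>2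
        \<le> (LINT x:{p..r}|lborel. ?F x)"
      using pr by (intro tanh_weight_bound \<phi> si)
    moreover have "\<kappa> * tanh (\<kappa> * (T - T)) * (cmod (\<phi> T))\<^sup>2 - \<kappa> * tanh (\<kappa> * (r - T)) * (cmod (\<phi> r))\<^sup>2
        \<le> (LINT x:{r..T}|lborel. ?F x)"
      using T by (intro tanh_weight_bound \<phi> si) auto
    moreover have "tanh (\<kappa> * (r - T)) = - tanh (\<kappa> * (T + - r))"
      by (simp flip: tanh_minus add: algebra_simps)
    moreover have "(LINT x:{-T..p}|lborel. ?F x) + (LINT x:{p..r}|lborel. ?F x) + (LINT x:{r..T}|lborel. ?F x)
        \<le> integral\<^sup>L lborel ?F"
    proof -
      have "(LINT x:{-T..p}|lborel. ?F x) + (LINT x:{p..r}|lborel. ?F x) + (LINT x:{r..T}|lborel. ?F x) =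
        (LINT x|lborel. indicator {-T..p} x *\<^sub>R ?F x + indicator {p..r} x *\<^sub>R ?F x + indicator {r..T} x *\<^sub>R ?F x)"
        unfolding set_lebesgue_integral_def
        using ii[of "{-T..p}"] ii[of "{p..r}"] ii[of "{r..T}"] unfolding set_integrable_def
        by (subst Bochner_Integration.integral_add, (intro Bochner_Integration.integrable_add | simp; fail)+)+
      also have "\<dots> \<le> integral\<^sup>L lborel ?F"
      proof (rule integral_mono_AE)
        \<comment> \<open>The closed intervals overlap only at \<open>p\<close> and \<open>r\<close>
          (if \<open>p = r\<close>, the middle one is a single point), so almost everywhere the
          indicators sum to at most 1.\<close>
        have "AE x in lborel. x \<noteq> p \<and> x \<noteq> r"
          using AE_lborel_singleton[of p] AE_lborel_singleton[of r] by eventually_elim auto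
        then show "AE x in lborel. indicator {-T..p} x *\<^sub>R ?F x + indicator {p..r} x *\<^sub>R ?F x + indicator {r..T} x *\<^sub>R ?F x \<le> ?F x"
          by eventually_elim (use pr in \<open>auto simp: indicator_def\<close>)
      qed (use ii in \<open>auto simp: set_integrable_def si intro!: Bochner_Integration.integrable_add\<close>)
      finally show ?thesis .
    qed
    ultimately show ?thesis by (simp add: algebra_simps)
  qed
  have "((\<lambda>T. \<kappa> * (tanh (\<kappa> * (T + - r)) + tanh (\<kappa> * (r - b))) * (cmod (\<phi> r))\<^sup>2
      + \<kappa> * (tanh (\<kappa> * (T + p)) - tanh (\<kappa> * (p - b))) * (cmod (\<phi> p))\<^sup>2) \<longlongrightarrow> ?L) at_top"
    by (intro tendsto_intros tanh_tendsto_at_top \<kappa>)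
  then show ?thesis
    by (rule tendsto_upperbound[OF _ eventually_at_top_linorderI[of "max \<bar>p\<bar> \<bar>r\<bar>"]]) (use le in auto)
qed

section \<open>A Hardy inequality on the line\<close>

lemma tendsto_integral_symmetric_Icc:
  fixes f :: "real \<Rightarrow> 'a::{banach,second_countable_topology}"
  assumes "integrable lborel f"
  shows "(\<lambda>n. LINT x:{- real n..real n}|lborel. f x) \<longlonglongrightarrow> integral\<^sup>L lborel f"
  unfolding set_lebesgue_integral_def
proof (rule integral_dominated_convergence)
  show "integrable lborel (\<lambda>x. norm (f x))" using assms by auto
  show "AE x in lborel. (\<lambda>n. indicator {- real n..real n} x *\<^sub>R f x) \<longlonglongrightarrow> f x"
  proof (rule AE_I2)
    fix x
    have "eventually (\<lambda>n. indicator {- real n..real n} x *\<^sub>R f x = f x) sequentially"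
      using eventually_ge_at_top[of "nat \<lceil>\<bar>x\<bar>\<rceil>"]
      by eventually_elim (auto simp: indicator_def abs_le_iff nat_le_iff ceiling_le_iff)
    then show "(\<lambda>n. indicator {- real n..real n} x *\<^sub>R f x) \<longlonglongrightarrow> f x"
      by (rule tendsto_eventually)
  qed
qed (use assms in \<open>auto simp: indicator_def\<close>)

text \<open>The left side is \<open>w' + w\<^sup>2\<close> for the weight
  \<open>w = d * z / ((R / 2)\<^sup>2 + z\<^sup>2)\<close>, so this is the Riccati condition for the
  potential that equals \<mu> on the interval of radius \<open>R\<close>, minus the Hardy
  weight.\<close>

lemma hardy_weight_le:
  fixes z d \<mu> R c :: real
  assumes "R > 0" "\<mu> > 0"
    and d: "d = min (1/2) (\<mu> * R\<^sup>2 / 8)" and c: "c = min (\<mu> / 2) (4 * d / 25)"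
  shows "d * ((R / 2)\<^sup>2 - z\<^sup>2) / ((R / 2)\<^sup>2 + z\<^sup>2)\<^sup>2 + (d * z / ((R / 2)\<^sup>2 + z\<^sup>2))\<^sup>2
    \<le> \<mu> * (if \<bar>z\<bar> < R then 1 else 0) - c * (1 / (1 + z\<^sup>2))"
proof -
  define r where "r = R / 2"
  have r: "r > 0" "R = 2 * r" and R2: "R\<^sup>2 = 4 * r\<^sup>2" using assms by (auto simp: r_def power2_eq_square)
  have d0: "d > 0" "d \<le> 1/2" "d \<le> \<mu> * r\<^sup>2 / 2" using assms R2 r by auto
  have c0: "c > 0" "c \<le> \<mu> / 2" "c \<le> 4 * d / 25" using c d0 assms by auto
  have r2: "r\<^sup>2 > 0" using r by simp
  have pos: "r\<^sup>2 + z\<^sup>2 > 0" using r2 by (simp add: add_pos_nonneg)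
  have "d * (r\<^sup>2 - z\<^sup>2) / (r\<^sup>2 + z\<^sup>2)\<^sup>2 + (d * z / (r\<^sup>2 + z\<^sup>2))\<^sup>2
      = d * (r\<^sup>2 - (1 - d) * z\<^sup>2) / (r\<^sup>2 + z\<^sup>2)\<^sup>2" (is "?q = _")
    by (simp add: power_divide power_mult_distrib flip: add_divide_distrib) (simp add: power2_eq_square algebra_simps)
  also have "\<dots> \<le> \<mu> * (if \<bar>z\<bar> < R then 1 else 0) - c * (1 / (1 + z\<^sup>2))"
  proof (cases "\<bar>z\<bar> < R")
    case True
    \<comment> \<open>Inside the interval the expression is at most \<open>d / r\<^sup>2\<close>.
      The choice \<open>d \<le> \<mu> * R\<^sup>2 / 8\<close> makes this at most
      \<open>\<mu> / 2\<close>, and \<open>c \<le> \<mu> / 2\<close> leaves the other half for the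
      Hardy weight.\<close>
    have "d * (r\<^sup>2 - (1 - d) * z\<^sup>2) / (r\<^sup>2 + z\<^sup>2)\<^sup>2 \<le> d * r\<^sup>2 / (r\<^sup>2 + z\<^sup>2)\<^sup>2"
      using d0 by (intro divide_right_mono mult_left_mono) auto
    also have "\<dots> \<le> d * r\<^sup>2 / (r\<^sup>2)\<^sup>2"
      using d0 r2 by (intro divide_left_mono mult_pos_pos power_mono) (auto intro!: mult_pos_pos add_pos_nonneg)
    also have "\<dots> \<le> \<mu> / 2"
      using d0(3) r2 \<open>\<mu> > 0\<close> by (simp add: power2_eq_square field_simps)
    finally have A: "d * (r\<^sup>2 - (1 - d) * z\<^sup>2) / (r\<^sup>2 + z\<^sup>2)\<^sup>2 \<le> \<mu> / 2" .
    have "c * (1 / (1 + z\<^sup>2)) \<le> c * 1"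
      using c0 by (intro mult_left_mono) (auto simp: divide_simps add_pos_nonneg)
    then have "d * (r\<^sup>2 - (1 - d) * z\<^sup>2) / (r\<^sup>2 + z\<^sup>2)\<^sup>2 \<le> \<mu> - c * (1 / (1 + z\<^sup>2))"
      using A c0(2) by argo
    then show ?thesis using True by simp
  next
    case False
    then have "R\<^sup>2 \<le> \<bar>z\<bar>\<^sup>2" using assms by (intro power_mono) auto
    then have z: "4 * r\<^sup>2 \<le> z\<^sup>2" using R2 by simp
    then have z0: "z\<^sup>2 > 0" using r2 by linarith
    \<comment> \<open>Outside, \<open>z\<^sup>2 \<ge> 4 * r\<^sup>2\<close> and
      \<open>d \<le> 1/2\<close> force the numerator below \<open>- z\<^sup>2 / 4\<close>, while
      \<open>r\<^sup>2 + z\<^sup>2 \<le> 5 / 4 * z\<^sup>2\<close>. This is the origin of the factor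
      \<open>4 / 25\<close> in the bound for \<open>c\<close>.\<close>
    have "z\<^sup>2 * (1/2) \<le> z\<^sup>2 * (1 - d)" using d0 by (intro mult_left_mono) auto
    then have "r\<^sup>2 - (1 - d) * z\<^sup>2 \<le> - (z\<^sup>2 / 4)" using z by (simp add: algebra_simps)
    then have "d * (r\<^sup>2 - (1 - d) * z\<^sup>2) / (r\<^sup>2 + z\<^sup>2)\<^sup>2 \<le> d * (- (z\<^sup>2 / 4)) / (r\<^sup>2 + z\<^sup>2)\<^sup>2"
      using d0 by (intro divide_right_mono mult_left_mono) auto
    also have "\<dots> = - (d * z\<^sup>2 / 4 / (r\<^sup>2 + z\<^sup>2)\<^sup>2)" by simp
    also have "\<dots> \<le> - (d * z\<^sup>2 / 4 / (5 / 4 * z\<^sup>2)\<^sup>2)"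
      using d0 z z0 pos by (intro le_imp_neg_le divide_left_mono power_mono) auto
    also have "d * z\<^sup>2 / 4 / (5 / 4 * z\<^sup>2)\<^sup>2 = 4 * d / 25 * (1 / z\<^sup>2)"
      using z0 by (simp add: power2_eq_square field_simps)
    also have "- \<dots> \<le> - (c * (1 / (1 + z\<^sup>2)))"
      using c0 d0 z0 by (intro le_imp_neg_le mult_mono divide_left_mono) (auto intro!: mult_pos_pos add_pos_pos)
    finally show ?thesis using False by simp
  qed
  finally show ?thesis by (simp only: r_def)
qed

text \<open>The constant is chosen before the centre \<open>y\<close> and the function, hence it
  depends on \<open>R\<close> and \<mu> only. The estimate is the Riccati bound on
  \<open>[-n, n]\<close>, followed by the limit in \<open>n\<close>.\<close>

lemma hardy_inequality:
  assumes R: "R > 0" and \<mu>: "\<mu> > 0"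
  shows "\<exists>c>0. \<forall>y \<phi> (g :: real \<Rightarrow> complex). primitive \<phi> g \<longrightarrow>
     integrable lborel (\<lambda>x. (cmod (\<phi> x))\<^sup>2) \<longrightarrow> integrable lborel (\<lambda>x. (cmod (g x))\<^sup>2) \<longrightarrow>
     c * (LINT x|lborel. 1 / (1 + (x - y)\<^sup>2) * (cmod (\<phi> x))\<^sup>2)
       \<le> (LINT x|lborel. (cmod (g x))\<^sup>2) + \<mu> * (LINT x|lborel. indicator {y - R<..<y + R} x * (cmod (\<phi> x))\<^sup>2)"
proof -
  define d where "d = min (1/2) (\<mu> * R\<^sup>2 / 8)"
  define c where "c = min (\<mu> / 2) (4 * d / 25)"
  have d0: "d > 0" using assms by (simp add: d_def)
  have c0: "c > 0" using \<mu> d0 by (simp add: c_def)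
  have "c * (LINT x|lborel. 1 / (1 + (x - y)\<^sup>2) * (cmod (\<phi> x))\<^sup>2)
       \<le> (LINT x|lborel. (cmod (g x))\<^sup>2) + \<mu> * (LINT x|lborel. indicator {y - R<..<y + R} x * (cmod (\<phi> x))\<^sup>2)"
    if \<phi>: "primitive \<phi> g" and i\<phi>: "integrable lborel (\<lambda>x. (cmod (\<phi> x))\<^sup>2)"
      and ig: "integrable lborel (\<lambda>x. (cmod (g x))\<^sup>2)" for y and \<phi> g :: "real \<Rightarrow> complex"
  proof -
    define q where "q = (\<lambda>x. \<mu> * indicator {y - R<..<y + R} x - c * (1 / (1 + (x - y)\<^sup>2)))"
    define w where "w = (\<lambda>x. d * (x - y) / ((R / 2)\<^sup>2 + (x - y)\<^sup>2))"
    define w' where "w' = (\<lambda>x. d * ((R / 2)\<^sup>2 - (x - y)\<^sup>2) / ((R / 2)\<^sup>2 + (x - y)\<^sup>2)\<^sup>2)"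
    have pos: "(R / 2)\<^sup>2 + z\<^sup>2 > 0" for z using R by (simp add: add_pos_nonneg)
    have nz: "(R / 2)\<^sup>2 + z\<^sup>2 \<noteq> 0" for z using pos[of z] by linarith
    have [measurable]: "(\<lambda>x. (cmod (\<phi> x))\<^sup>2) \<in> borel_measurable borel" using i\<phi> by auto
    have i1: "integrable lborel (\<lambda>x. indicator {y - R<..<y + R} x * (cmod (\<phi> x))\<^sup>2)"
      using integrable_mult_indicator[OF _ i\<phi>, of "{y - R<..<y + R}"] by simp
    have i2: "integrable lborel (\<lambda>x. 1 / (1 + (x - y)\<^sup>2) * (cmod (\<phi> x))\<^sup>2)"
      by (rule Bochner_Integration.integrable_bound[OF i\<phi>])
        (auto simp: divide_simps add_pos_nonneg distrib_left)
    have eq: "(\<lambda>x. (cmod (g x))\<^sup>2 + q x * (cmod (\<phi> x))\<^sup>2) =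
        (\<lambda>x. (cmod (g x))\<^sup>2 + (\<mu> * (indicator {y - R<..<y + R} x * (cmod (\<phi> x))\<^sup>2)
          - c * (1 / (1 + (x - y)\<^sup>2) * (cmod (\<phi> x))\<^sup>2)))"
      by (simp add: q_def algebra_simps)
    have iq: "integrable lborel (\<lambda>x. (cmod (g x))\<^sup>2 + q x * (cmod (\<phi> x))\<^sup>2)"
      unfolding eq using ig i1 i2 by (intro Bochner_Integration.integrable_add Bochner_Integration.integrable_diff integrable_mult_right)
    have "eventually (\<lambda>n. 0 \<le> (LINT x:{- real n..real n}|lborel. (cmod (g x))\<^sup>2 + q x * (cmod (\<phi> x))\<^sup>2)) sequentially"
      using eventually_ge_at_top[of "nat \<lceil>\<bar>y\<bar>\<rceil>"]
    proof eventually_elim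
      case (elim n)
      then have n: "\<bar>y\<bar> \<le> real n" by linarith
      have "0 \<le> w (real n)" "w (- real n) \<le> 0"
        using n d0 pos by (auto simp: w_def zero_le_divide_iff divide_le_0_iff zero_le_mult_iff mult_le_0_iff less_imp_le)
      then have "0 \<le> w (real n) * (cmod (\<phi> (real n)))\<^sup>2 - w (- real n) * (cmod (\<phi> (- real n)))\<^sup>2"
        by (smt (verit) mult_nonneg_nonneg mult_nonpos_nonneg zero_le_power2)
      also have "\<dots> \<le> (LINT x:{- real n..real n}|lborel. (cmod (g x))\<^sup>2 + q x * (cmod (\<phi> x))\<^sup>2)"
      proof (rule riccati_weight_bound[OF \<phi>])
        show "(w has_real_derivative w' x) (at x)" for x
          unfolding w_def w'_def
          by (rule derivative_eq_intros refl nz | simp)+ (simp add: power2_eq_square algebra_simps)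
        show "continuous_on UNIV w'"
          unfolding w'_def using nz by (intro continuous_intros) auto
        show "set_integrable lborel {- real n..real n} (\<lambda>x. (cmod (g x))\<^sup>2 + q x * (cmod (\<phi> x))\<^sup>2)"
          unfolding set_integrable_def by (intro integrable_mult_indicator iq) auto
        show "w' x + (w x)\<^sup>2 \<le> q x" for x
        proof -
          have "indicator {y - R<..<y + R} x = (if \<bar>x - y\<bar> < R then 1 else (0::real))"
            by (auto simp: indicator_def)
          then show ?thesis
            using hardy_weight_le[OF R \<mu> d_def c_def, of "x - y"] by (simp only: w_def w'_def q_def)
        qed
      qed simp
      finally show ?case .
    qed
    then have "0 \<le> (LINT x|lborel. (cmod (g x))\<^sup>2 + q x * (cmod (\<phi> x))\<^sup>2)"
      by (intro tendsto_lowerbound[OF tendsto_integral_symmetric_Icc[OF iq]]) auto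
    also have "\<dots> = (LINT x|lborel. (cmod (g x))\<^sup>2) + (\<mu> * (LINT x|lborel. indicator {y - R<..<y + R} x * (cmod (\<phi> x))\<^sup>2)
       - c * (LINT x|lborel. 1 / (1 + (x - y)\<^sup>2) * (cmod (\<phi> x))\<^sup>2))"
      unfolding eq
      by (simp only: Bochner_Integration.integral_add[OF ig Bochner_Integration.integrable_diff[OF
            integrable_mult_right[OF i1] integrable_mult_right[OF i2]]]
          Bochner_Integration.integral_diff[OF integrable_mult_right[OF i1] integrable_mult_right[OF i2]]
          integral_mult_right_zero)
    finally show ?thesis by simp
  qed
  with c0 show ?thesis by blast
qed

subsection \<open>The ground state of the double delta interaction\<close>

lemma primitive_add:
  assumes "primitive F f" "primitive G g"
  shows "primitive (\<lambda>x. F x + G x) (\<lambda>x. f x + g x)"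
  unfolding primitive_def
proof (intro allI impI conjI)
  fix s t :: real
  assume st: "s \<le> t"
  have i: "set_integrable lborel {s..t} f" "set_integrable lborel {s..t} g"
    using assms by (auto intro: primitive_set_integrable)
  show "set_integrable lborel {s..t} (\<lambda>x. f x + g x)"
    using i by (rule set_integral_add)
  have "(F t + G t) - (F s + G s) = (F t - F s) + (G t - G s)" by simp
  also have "\<dots> = (LINT x:{s..t}|lborel. f x) + (LINT x:{s..t}|lborel. g x)"
    by (simp only: primitive_diff[OF assms(1) st] primitive_diff[OF assms(2) st])
  also have "\<dots> = (LINT x:{s..t}|lborel. f x + g x)"
    using i by (rule set_integral_add(2)[symmetric])
  finally show "(F t + G t) - (F s + G s) = (LINT x:{s..t}|lborel. f x + g x)" .
qed

section \<open>Exponential kernels\<close>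

lemma integrable_exp_abs:
  fixes k b :: real
  assumes "k > 0"
  shows "integrable lborel (\<lambda>t. exp (- k * \<bar>t - b\<bar>))"
proof -
  have half: "integrable lborel (\<lambda>t. exp (- k * t) * indicator {0..} t)"
  proof (rule integrableI_nonneg)
    have "((\<lambda>t. - exp (- (k * t)) / k) \<longlongrightarrow> - 0 / k) at_top"
      using assms by (intro tendsto_intros filterlim_compose[OF exp_at_bot]
        filterlim_compose[OF filterlim_uminus_at_bot_at_top] filterlim_tendsto_pos_mult_at_top[OF tendsto_const] filterlim_ident)
        auto
    then have "(\<integral>\<^sup>+ t. ennreal (exp (- k * t)) * indicator {0..} t \<partial>lborel) = ennreal (- 0 / k - (- exp (- (k * 0)) / k))"
      using assms by (intro nn_integral_FTC_atLeast) (auto intro!: derivative_eq_intros)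
    moreover have "(\<integral>\<^sup>+ t. ennreal (exp (- k * t) * indicator {0..} t) \<partial>lborel) =
        (\<integral>\<^sup>+ t. ennreal (exp (- k * t)) * indicator {0..} t \<partial>lborel)"
      by (intro nn_integral_cong) (auto simp: indicator_def)
    ultimately show "(\<integral>\<^sup>+ t. ennreal (exp (- k * t) * indicator {0..} t) \<partial>lborel) < \<infinity>"
      by simp
  qed auto
  \<comment> \<open>Two half-line exponentials, one reflected, are glued at \<open>b\<close>. Both
    are present at \<open>b\<close> itself, so their sum serves as a dominating function.\<close>
  have "integrable lborel (\<lambda>t. exp (- k * (- b + 1 * t)) * indicator {0..} (- b + 1 * t)
      + exp (- k * (b + - 1 * t)) * indicator {0..} (b + - 1 * t))"
    by (intro Bochner_Integration.integrable_add
        lborel_integrable_real_affine[OF half, of 1] lborel_integrable_real_affine[OF half, of "-1"]) auto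
  then show ?thesis
    by (rule Bochner_Integration.integrable_bound) (auto simp: indicator_def abs_if)
qed

definition exp_kernel :: "real \<Rightarrow> real \<Rightarrow> real \<Rightarrow> real" where
  "exp_kernel k b t = exp (- k * \<bar>t - b\<bar>)"

text \<open>The derivative of \<open>exp_kernel\<close> away from its kink; at \<open>t = b\<close>
  the value is 0, since \<open>sgn 0 = 0\<close>.\<close>

definition exp_kernel' :: "real \<Rightarrow> real \<Rightarrow> real \<Rightarrow> real" where
  "exp_kernel' k b t = - k * sgn (t - b) * exp (- k * \<bar>t - b\<bar>)"

lemma exp_kernel_measurable [measurable]:
  "exp_kernel k b \<in> borel_measurable borel" "exp_kernel' k b \<in> borel_measurable borel"
  unfolding exp_kernel_def[abs_def] exp_kernel'_def[abs_def] by measurable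

lemma exp_kernel_pos: "0 < exp_kernel k b t"
  by (simp add: exp_kernel_def)

lemma exp_kernel_le_1: "0 < k \<Longrightarrow> exp_kernel k b t \<le> 1"
  by (simp add: exp_kernel_def)

lemma abs_exp_kernel'_le: "0 < k \<Longrightarrow> \<bar>exp_kernel' k b t\<bar> \<le> k * exp_kernel k b t"
  by (auto simp: exp_kernel_def exp_kernel'_def abs_mult sgn_if)

lemma integrable_exp_kernel: "0 < k \<Longrightarrow> integrable lborel (exp_kernel k b)"
  unfolding exp_kernel_def[abs_def] by (rule integrable_exp_abs)

lemma primitive_exp_kernel:
  assumes k: "k > 0"
  shows "primitive (exp_kernel k b) (exp_kernel' k b)"
  unfolding primitive_def
proof (intro allI impI conjI)
  fix s t :: real
  assume st: "s \<le> t"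
  have "integrable lborel (exp_kernel' k b)"
    by (rule Bochner_Integration.integrable_bound[OF integrable_mult_right[OF integrable_exp_kernel[OF k, of b], of k]])
      (use k abs_exp_kernel'_le[OF k] exp_kernel_pos in \<open>auto simp: abs_mult less_imp_le\<close>)
  then show si: "set_integrable lborel {s..t} (exp_kernel' k b)"
    unfolding set_integrable_def by (intro integrable_mult_indicator) auto
  have "(exp_kernel' k b has_integral exp_kernel k b t - exp_kernel k b s) {s..t}"
  \<comment> \<open>The kink at \<open>b\<close> is the exceptional point at which only continuity
    is used.\<close>
  proof (rule fundamental_theorem_of_calculus_interior_strong[of "{b}"])
    fix x assume "x \<in> {s<..<t} - {b}"
    then consider "x < b" | "b < x" by fastforce
    then have "(exp_kernel k b has_real_derivative exp_kernel' k b x) (at x)"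
    proof cases
      case 1
      have "((\<lambda>t. exp (k * (t - b))) has_real_derivative exp_kernel' k b x) (at x)"
        using 1 by (auto intro!: derivative_eq_intros simp: exp_kernel'_def algebra_simps)
      then show ?thesis
        by (rule has_field_derivative_transform_within_open[of _ _ _ "{..<b}"])
          (use 1 in \<open>auto simp: exp_kernel_def algebra_simps\<close>)
    next
      case 2
      have "((\<lambda>t. exp (- k * (t - b))) has_real_derivative exp_kernel' k b x) (at x)"
        using 2 by (auto intro!: derivative_eq_intros simp: exp_kernel'_def)
      then show ?thesis
        by (rule has_field_derivative_transform_within_open[of _ _ _ "{b<..}"])
          (use 2 in \<open>auto simp: exp_kernel_def\<close>)
    qed
    then show "(exp_kernel k b has_vector_derivative exp_kernel' k b x) (at x)"
      by (simp add: has_real_derivative_iff_has_vector_derivative)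
  qed (use st in \<open>auto simp: exp_kernel_def[abs_def] intro!: continuous_intros\<close>)
  then show "exp_kernel k b t - exp_kernel k b s = (LINT u:{s..t}|lborel. exp_kernel' k b u)"
    using set_borel_integral_eq_integral(2)[OF si] integral_unique by metis
qed

section \<open>Square integrability and the Sobolev space on the line\<close>

lemma integrable_mult_square_integrable:
  fixes u v :: "real \<Rightarrow> complex"
  assumes [measurable]: "u \<in> borel_measurable lborel" "v \<in> borel_measurable lborel"
    and "integrable lborel (\<lambda>t. (cmod (u t))\<^sup>2)" "integrable lborel (\<lambda>t. (cmod (v t))\<^sup>2)"
  shows "integrable lborel (\<lambda>t. u t * v t)"
proof (rule Bochner_Integration.integrable_bound)
  show "integrable lborel (\<lambda>t. (cmod (u t))\<^sup>2 + (cmod (v t))\<^sup>2)"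
    using assms by (intro Bochner_Integration.integrable_add)
  have "cmod (u t) * cmod (v t) \<le> (cmod (u t))\<^sup>2 + (cmod (v t))\<^sup>2" for t
  proof -
    have "2 * (cmod (u t) * cmod (v t)) \<le> (cmod (u t))\<^sup>2 + (cmod (v t))\<^sup>2"
      using sum_squares_bound[of "cmod (u t)" "cmod (v t)"] by simp
    moreover have "0 \<le> cmod (u t) * cmod (v t)" by simp
    ultimately show ?thesis by linarith
  qed
  then show "AE t in lborel. norm (u t * v t) \<le> norm ((cmod (u t))\<^sup>2 + (cmod (v t))\<^sup>2)"
    by (simp add: norm_mult)
qed measurable

lemma W12_1d_iff_primitive:
  "W12_1d \<phi> g \<longleftrightarrow> \<phi> \<in> borel_measurable lborel \<and> g \<in> borel_measurable lborel \<and>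
     integrable lborel (\<lambda>t. (cmod (\<phi> t))\<^sup>2) \<and> integrable lborel (\<lambda>t. (cmod (g t))\<^sup>2) \<and> primitive \<phi> g"
  by (simp add: W12_1d_def primitive_def)

lemma W12_1d_cnj: "W12_1d \<phi> g \<Longrightarrow> W12_1d (\<lambda>t. cnj (\<phi> t)) (\<lambda>t. cnj (g t))"
  by (auto simp: W12_1d_iff_primitive intro: primitive_bounded_linear[OF bounded_linear_cnj]
      intro!: borel_measurable_continuous_on[OF continuous_on_cnj[OF continuous_on_id]])

lemma W12_1d_add:
  assumes "W12_1d \<phi> g" "W12_1d \<eta> h"
  shows "W12_1d (\<lambda>t. \<phi> t + \<eta> t) (\<lambda>t. g t + h t)"
proof -
  have sq: "integrable lborel (\<lambda>t. (cmod (u t + v t))\<^sup>2)"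
    if [measurable]: "u \<in> borel_measurable lborel" "v \<in> borel_measurable lborel"
      and i: "integrable lborel (\<lambda>t. (cmod (u t))\<^sup>2)" "integrable lborel (\<lambda>t. (cmod (v t))\<^sup>2)" for u v :: "real \<Rightarrow> complex"
  proof (rule Bochner_Integration.integrable_bound)
    show "integrable lborel (\<lambda>t. 2 * (cmod (u t))\<^sup>2 + 2 * (cmod (v t))\<^sup>2)"
      using i by (intro Bochner_Integration.integrable_add integrable_mult_right)
    have "(cmod (u t + v t))\<^sup>2 \<le> 2 * (cmod (u t))\<^sup>2 + 2 * (cmod (v t))\<^sup>2" for t
    proof -
      have "(cmod (u t + v t))\<^sup>2 \<le> (cmod (u t) + cmod (v t))\<^sup>2"
        by (intro power_mono norm_triangle_ineq) auto
      also have "\<dots> \<le> 2 * (cmod (u t))\<^sup>2 + 2 * (cmod (v t))\<^sup>2"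
        using sum_squares_bound[of "cmod (u t)" "cmod (v t)"] by (simp add: power2_sum)
      finally show ?thesis .
    qed
    then show "AE t in lborel. norm ((cmod (u t + v t))\<^sup>2) \<le> norm (2 * (cmod (u t))\<^sup>2 + 2 * (cmod (v t))\<^sup>2)"
      by simp
  qed measurable
  show ?thesis
    using assms unfolding W12_1d_iff_primitive by (auto intro: primitive_add sq)
qed

text \<open>Since the kernel lies between 0 and 1, its square is dominated by the kernel itself, and
  the square of its derivative by \<open>k\<^sup>2\<close> times the kernel.\<close>

lemma W12_1d_exp_kernel:
  assumes k: "k > 0"
  shows "W12_1d (\<lambda>t. of_real (exp_kernel k b t)) (\<lambda>t. of_real (exp_kernel' k b t))"
proof -
  have le: "(exp_kernel k b t)\<^sup>2 \<le> exp_kernel k b t" for t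
    using exp_kernel_pos[of k b t] exp_kernel_le_1[OF k, of b t]
    by (simp add: power2_eq_square mult_left_le)
  have le': "(exp_kernel' k b t)\<^sup>2 \<le> k\<^sup>2 * exp_kernel k b t" for t
  proof -
    have "\<bar>exp_kernel' k b t\<bar>\<^sup>2 \<le> (k * exp_kernel k b t)\<^sup>2"
      by (intro power_mono abs_exp_kernel'_le k) auto
    also have "\<dots> \<le> k\<^sup>2 * exp_kernel k b t"
      unfolding power_mult_distrib by (intro mult_left_mono le) auto
    finally show ?thesis by simp
  qed
  have i: "integrable lborel (\<lambda>t. (exp_kernel k b t)\<^sup>2)"
    by (rule Bochner_Integration.integrable_bound[OF integrable_exp_kernel[OF k, of b]])
      (use le exp_kernel_pos in \<open>auto simp: less_imp_le\<close>)
  have i': "integrable lborel (\<lambda>t. (exp_kernel' k b t)\<^sup>2)"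
    by (rule Bochner_Integration.integrable_bound[OF integrable_mult_right[OF integrable_exp_kernel[OF k, of b], of "k\<^sup>2"]])
      (use le' exp_kernel_pos in \<open>auto simp: less_imp_le abs_mult\<close>)
  show ?thesis
    using i i' primitive_bounded_linear[OF bounded_linear_of_real primitive_exp_kernel[OF k, of b]]
    by (simp add: W12_1d_iff_primitive)
qed

text \<open>The two-point bound with both points and the zero of the weight placed at
  \<open>t\<close>. The free parameter matters: \<kappa> = 1 yields boundedness and trace estimates,
  while a large \<kappa> shows that a function of zero norm vanishes everywhere.\<close>

lemma W12_1d_pointwise_bound:
  assumes "W12_1d \<phi> g" "\<kappa> > 0"
  shows "2 * \<kappa> * (cmod (\<phi> t))\<^sup>2 \<le> (LINT x|lborel. (cmod (g x))\<^sup>2) + \<kappa>\<^sup>2 * (LINT x|lborel. (cmod (\<phi> x))\<^sup>2)"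
proof -
  have i: "integrable lborel (\<lambda>x. (cmod (g x))\<^sup>2)" "integrable lborel (\<lambda>x. \<kappa>\<^sup>2 * (cmod (\<phi> x))\<^sup>2)"
    using assms by (auto simp: W12_1d_iff_primitive)
  have "\<kappa> * (1 + tanh (\<kappa> * (t - t))) * (cmod (\<phi> t))\<^sup>2 + \<kappa> * (1 - tanh (\<kappa> * (t - t))) * (cmod (\<phi> t))\<^sup>2
     \<le> (LINT x|lborel. (cmod (g x))\<^sup>2 + \<kappa>\<^sup>2 * (cmod (\<phi> x))\<^sup>2)"
    using assms i by (intro two_point_bound) (auto simp: W12_1d_iff_primitive)
  then show ?thesis using i by simp
qed

section \<open>The weak equation of the exponential kernel\<close>

text \<open>On either side of \<open>b\<close> the integrand is the derivative of
  \<open>exp_kernel' * \<zeta>\<close>. The jump of \<open>exp_kernel'\<close> at \<open>b\<close>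
  has size \<open>2 * k\<close> and produces the point value of \<zeta>.\<close>

lemma exp_kernel_integral_Icc:
  assumes k: "k > 0" and W: "W12_1d \<zeta> h" and T: "\<bar>b\<bar> \<le> T"
  shows "(LINT t:{-T..T}|lborel. of_real (exp_kernel' k b t) * h t + (of_real k)\<^sup>2 * (of_real (exp_kernel k b t) * \<zeta> t))
    = 2 * of_real k * \<zeta> b - of_real (k * exp_kernel k b T) * \<zeta> T - of_real (k * exp_kernel k b (-T)) * \<zeta> (-T)"
    (is "(LINT t:_|_. ?F t) = _")
proof -
  have \<zeta>: "primitive \<zeta> h" and m [measurable]: "\<zeta> \<in> borel_measurable borel" "h \<in> borel_measurable borel"
    using W by (auto simp: W12_1d_iff_primitive)
  \<comment> \<open>Smooth branches of the kernel derivative: \<open>c = k\<close> to the left of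
    \<open>b\<close> and \<open>c = -k\<close> to the right. In both cases \<open>P' c\<close> is
    \<open>k\<^sup>2\<close> times the kernel.\<close>
  define P where "P = (\<lambda>c t. complex_of_real (c * exp (c * (t - b))))"
  define P' where "P' = (\<lambda>c t. complex_of_real (c\<^sup>2 * exp (c * (t - b))))"
  have "primitive (P c) (P' c)" for c
    unfolding P_def P'_def
    by (intro primitive_continuous_derivative continuous_intros)
      (auto intro!: has_vector_derivative_of_real derivative_eq_intros
        simp: has_real_derivative_iff_has_vector_derivative[symmetric] power2_eq_square)
  then have PP: "primitive (\<lambda>t. P c t * \<zeta> t) (\<lambda>t. P' c t * \<zeta> t + P c t * h t)" for c
    using \<zeta> by (rule primitive_mult)
  have [measurable]: "P c \<in> borel_measurable borel" "P' c \<in> borel_measurable borel" for c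
    unfolding P_def P'_def by measurable
  have "(LINT t:{-T..T}|lborel. ?F t)
    = (LINT t|lborel. indicator {-T..b} t *\<^sub>R (P' k t * \<zeta> t + P k t * h t)
        + indicator {b..T} t *\<^sub>R (P' (-k) t * \<zeta> t + P (-k) t * h t))"
    unfolding set_lebesgue_integral_def
  proof (rule integral_cong_AE)
    show "AE t in lborel. indicator {-T..T} t *\<^sub>R ?F t =
        indicator {-T..b} t *\<^sub>R (P' k t * \<zeta> t + P k t * h t)
        + indicator {b..T} t *\<^sub>R (P' (-k) t * \<zeta> t + P (-k) t * h t)"
      using AE_lborel_singleton[of b]
    proof eventually_elim
      case (elim t)
      then consider "t < b" | "b < t" by fastforce
      then show ?case
      proof cases
        case 1
        then have "indicator {b..T} t = (0::real)" "indicator {-T..T} t = (indicator {-T..b} t :: real)"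
          using T by (auto simp: indicator_def)
        moreover have "exp_kernel k b t = exp (k * (t - b))" "exp_kernel' k b t = k * exp (k * (t - b))"
          using 1 by (auto simp: exp_kernel_def exp_kernel'_def algebra_simps)
        ultimately show ?thesis by (simp add: P_def P'_def)
      next
        case 2
        then have "indicator {-T..b} t = (0::real)" "indicator {-T..T} t = (indicator {b..T} t :: real)"
          using T by (auto simp: indicator_def)
        moreover have "exp_kernel k b t = exp (- k * (t - b))" "exp_kernel' k b t = - k * exp (- k * (t - b))"
          using 2 by (auto simp: exp_kernel_def exp_kernel'_def algebra_simps)
        ultimately show ?thesis by (simp add: P_def P'_def)
      qed
    qed
  qed measurable
  also have "\<dots> = (LINT t:{-T..b}|lborel. P' k t * \<zeta> t + P k t * h t)
      + (LINT t:{b..T}|lborel. P' (-k) t * \<zeta> t + P (-k) t * h t)"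
    unfolding set_lebesgue_integral_def
    using primitive_set_integrable[OF PP] by (intro Bochner_Integration.integral_add) (auto simp: set_integrable_def)
  also have "\<dots> = (P k b * \<zeta> b - P k (-T) * \<zeta> (-T)) + (P (-k) T * \<zeta> T - P (-k) b * \<zeta> b)"
    using T by (simp add: primitive_diff[OF PP, symmetric])
  also have "\<dots> = 2 * of_real k * \<zeta> b - of_real (k * exp_kernel k b T) * \<zeta> T - of_real (k * exp_kernel k b (-T)) * \<zeta> (-T)"
  proof -
    have "P k b = of_real k" "P (-k) b = - of_real k" by (simp_all add: P_def)
    moreover have "P (-k) T = - of_real (k * exp_kernel k b T)" "P k (-T) = of_real (k * exp_kernel k b (-T))"
      using T by (auto simp: P_def exp_kernel_def algebra_simps)
    ultimately show ?thesis by (simp add: algebra_simps)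
  qed
  finally show ?thesis .
qed

lemma exp_kernel_tendsto_0:
  assumes "k > 0"
  shows "(\<lambda>n. exp_kernel k b (real n)) \<longlonglongrightarrow> 0" "(\<lambda>n. exp_kernel k b (- real n)) \<longlonglongrightarrow> 0"
proof -
  have *: "(\<lambda>n. exp (k * c) * exp (- (k * real n))) \<longlonglongrightarrow> exp (k * c) * 0" for c
    using assms by (intro tendsto_intros filterlim_compose[OF exp_at_bot]
        filterlim_compose[OF filterlim_uminus_at_bot_at_top] filterlim_tendsto_pos_mult_at_top[OF tendsto_const]
        filterlim_real_sequentially) auto
  have ev: "eventually (\<lambda>n. \<bar>b\<bar> \<le> real n) sequentially"
    using eventually_ge_at_top[of "nat \<lceil>\<bar>b\<bar>\<rceil>"] by eventually_elim linarith
  show "(\<lambda>n. exp_kernel k b (real n)) \<longlonglongrightarrow> 0"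
  proof (rule Lim_transform_eventually)
    show "(\<lambda>n. exp (k * b) * exp (- (k * real n))) \<longlonglongrightarrow> 0" using *[of b] by simp
    show "\<forall>\<^sub>F n in sequentially. exp (k * b) * exp (- (k * real n)) = exp_kernel k b (real n)"
      using ev by eventually_elim (auto simp: exp_kernel_def algebra_simps simp flip: exp_add)
  qed
  show "(\<lambda>n. exp_kernel k b (- real n)) \<longlonglongrightarrow> 0"
  proof (rule Lim_transform_eventually)
    show "(\<lambda>n. exp (k * - b) * exp (- (k * real n))) \<longlonglongrightarrow> 0" using *[of "-b"] by simp
    show "\<forall>\<^sub>F n in sequentially. exp (k * - b) * exp (- (k * real n)) = exp_kernel k b (- real n)"
      using ev by eventually_elim (auto simp: exp_kernel_def algebra_simps simp flip: exp_add)
  qed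
qed

text \<open>\<open>exp_kernel k b\<close> is the Green's function of \<open>-d\<^sup>2/dt\<^sup>2 + k\<^sup>2\<close> up to the factor \<open>2 k\<close>.\<close>
lemma exp_kernel_weak_equation:
  assumes k: "k > 0" and W: "W12_1d \<zeta> h"
  shows "integrable lborel (\<lambda>t. of_real (exp_kernel' k b t) * h t)"
    and "integrable lborel (\<lambda>t. of_real (exp_kernel k b t) * \<zeta> t)"
    and "(LINT t|lborel. of_real (exp_kernel' k b t) * h t)
      + (of_real k)\<^sup>2 * (LINT t|lborel. of_real (exp_kernel k b t) * \<zeta> t) = 2 * of_real k * \<zeta> b"
proof -
  show i1: "integrable lborel (\<lambda>t. of_real (exp_kernel' k b t) * h t)"
    and i2: "integrable lborel (\<lambda>t. of_real (exp_kernel k b t) * \<zeta> t)"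
    using W W12_1d_exp_kernel[OF k, of b] unfolding W12_1d_iff_primitive
    by (auto intro!: integrable_mult_square_integrable)
  let ?F = "\<lambda>t. of_real (exp_kernel' k b t) * h t + (of_real k)\<^sup>2 * (of_real (exp_kernel k b t) * \<zeta> t)"
  have iF: "integrable lborel ?F"
    using i1 i2 by (intro Bochner_Integration.integrable_add integrable_mult_right)
  \<comment> \<open>The boundary terms at \<open>n\<close> and \<open>-n\<close> are values of
    \<zeta> times kernel values that tend to 0, so boundedness of \<zeta> makes them vanish in the
    limit.\<close>
  have "Bseq (\<lambda>n. \<zeta> (s n))" for s :: "nat \<Rightarrow> real"
  proof (rule BseqI')
    fix n
    define M where "M = (LINT x|lborel. (cmod (h x))\<^sup>2) + 1\<^sup>2 * (LINT x|lborel. (cmod (\<zeta> x))\<^sup>2)"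
    have "2 * 1 * (cmod (\<zeta> (s n)))\<^sup>2 \<le> M"
      unfolding M_def by (rule W12_1d_pointwise_bound[OF W]) simp
    then have "(cmod (\<zeta> (s n)))\<^sup>2 \<le> M" using zero_le_power2[of "cmod (\<zeta> (s n))"] by linarith
    then show "cmod (\<zeta> (s n)) \<le> sqrt M" by (rule real_le_rsqrt)
  qed
  then have lim0: "(\<lambda>n. of_real (k * x n) * \<zeta> (s n)) \<longlonglongrightarrow> 0" if "x \<longlonglongrightarrow> 0" for x and s :: "nat \<Rightarrow> real"
  proof -
    have "Zfun (\<lambda>n. complex_of_real (k * x n)) sequentially"
      using tendsto_of_real[OF tendsto_mult[OF tendsto_const that], of k, where 'a = complex] by (simp add: tendsto_Zfun_iff)
    then have "Zfun (\<lambda>n. of_real (k * x n) * \<zeta> (s n)) sequentially"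
      using \<open>Bseq (\<lambda>n. \<zeta> (s n))\<close> by (rule bounded_bilinear.Zfun_prod_Bfun[OF bounded_bilinear_mult])
    then show ?thesis by (simp add: tendsto_Zfun_iff)
  qed
  have "(\<lambda>n. LINT t:{- real n..real n}|lborel. ?F t) \<longlonglongrightarrow> 2 * of_real k * \<zeta> b - 0 - 0"
  proof (rule Lim_transform_eventually)
    show "(\<lambda>n. 2 * of_real k * \<zeta> b - of_real (k * exp_kernel k b (real n)) * \<zeta> (real n)
        - of_real (k * exp_kernel k b (- real n)) * \<zeta> (- real n)) \<longlonglongrightarrow> 2 * of_real k * \<zeta> b - 0 - 0"
      by (intro tendsto_diff tendsto_const lim0 exp_kernel_tendsto_0 k)
    show "eventually (\<lambda>n. 2 * of_real k * \<zeta> b - of_real (k * exp_kernel k b (real n)) * \<zeta> (real n)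
        - of_real (k * exp_kernel k b (- real n)) * \<zeta> (- real n) = (LINT t:{- real n..real n}|lborel. ?F t)) sequentially"
      using eventually_ge_at_top[of "nat \<lceil>\<bar>b\<bar>\<rceil>"]
    proof eventually_elim
      case (elim n)
      then have "\<bar>b\<bar> \<le> real n" by linarith
      then show ?case by (rule exp_kernel_integral_Icc[OF k W, symmetric])
    qed
  qed
  with tendsto_integral_symmetric_Icc[OF iF] have "integral\<^sup>L lborel ?F = 2 * of_real k * \<zeta> b - 0 - 0"
    by (rule LIMSEQ_unique)
  then show "(LINT t|lborel. of_real (exp_kernel' k b t) * h t)
      + (of_real k)\<^sup>2 * (LINT t|lborel. of_real (exp_kernel k b t) * \<zeta> t) = 2 * of_real k * \<zeta> b"
    using Bochner_Integration.integral_add[OF i1 integrable_mult_right[OF i2, of "(of_real k)\<^sup>2"]] by simp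
qed

section \<open>The lowest eigenvalue\<close>

text \<open>The relation between \<alpha> and \<open>k\<close> is the secular equation of the even
  bound state. The sum of the kernels at \<open>a\<close> and \<open>-a\<close> has the value
  \<open>1 + exp (- k * (2 * a))\<close> at both points, so \<alpha> times this value matches the
  point source \<open>2 * k\<close> of each kernel.\<close>

lemma is_eigenvalue_1d_exp_kernel:
  assumes k: "k > 0" and a: "a > 0" and \<alpha>: "\<alpha> * (1 + exp (- k * (2 * a))) = 2 * k"
  shows "is_eigenvalue_1d \<alpha> a (- (k\<^sup>2))"
  unfolding is_eigenvalue_1d_def
proof (intro exI conjI allI impI)
  let ?\<phi> = "\<lambda>t. complex_of_real (exp_kernel k a t) + of_real (exp_kernel k (-a) t)"
  let ?g = "\<lambda>t. complex_of_real (exp_kernel' k a t) + of_real (exp_kernel' k (-a) t)"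
  show "W12_1d ?\<phi> ?g"
    using k by (intro W12_1d_add W12_1d_exp_kernel)
  show "?\<phi> 0 \<noteq> 0"
    using exp_kernel_pos[of k a 0] exp_kernel_pos[of k "-a" 0]
    by (simp flip: of_real_add)
  fix \<eta> h assume "W12_1d \<eta> h"
  then have W: "W12_1d (\<lambda>t. cnj (\<eta> t)) (\<lambda>t. cnj (h t))" by (rule W12_1d_cnj)
  note K = exp_kernel_weak_equation[OF k W]
  have 1: "(LINT t|lborel. ?g t * cnj (h t)) = (LINT t|lborel. of_real (exp_kernel' k a t) * cnj (h t))
      + (LINT t|lborel. of_real (exp_kernel' k (-a) t) * cnj (h t))"
    unfolding distrib_right by (rule Bochner_Integration.integral_add[OF K(1) K(1)])
  have 2: "(LINT t|lborel. ?\<phi> t * cnj (\<eta> t)) = (LINT t|lborel. of_real (exp_kernel k a t) * cnj (\<eta> t))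
      + (LINT t|lborel. of_real (exp_kernel k (-a) t) * cnj (\<eta> t))"
    unfolding distrib_right by (rule Bochner_Integration.integral_add[OF K(2) K(2)])
  have "?\<phi> a = of_real (1 + exp (- k * (2 * a)))" "?\<phi> (-a) = of_real (1 + exp (- k * (2 * a)))"
    using a by (auto simp: exp_kernel_def)
  then have 3: "of_real \<alpha> * ?\<phi> a = 2 * of_real k" "of_real \<alpha> * ?\<phi> (-a) = 2 * of_real k"
    using \<alpha> by (metis of_real_mult of_real_numeral)+
  show "(LINT t|lborel. ?g t * cnj (h t)) - of_real \<alpha> * ?\<phi> a * cnj (\<eta> a) - of_real \<alpha> * ?\<phi> (-a) * cnj (\<eta> (-a))
      = of_real (- (k\<^sup>2)) * (LINT t|lborel. ?\<phi> t * cnj (\<eta> t))"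
    unfolding 1 2 3 using K(3)[of a] K(3)[of "-a"] by (simp add: algebra_simps add_eq_0_iff2)
qed

text \<open>The eigenvalue equation is tested with the eigenfunction itself. The two-point bound
  with zero of the weight at 0 has coefficient \<alpha> at both \<open>a\<close> and
  \<open>-a\<close>, exactly compensating the interaction.\<close>

lemma is_eigenvalue_1d_lower_bound:
  assumes k: "k > 0" and a: "a > 0" and \<alpha>: "\<alpha> = k * (1 + tanh (k * a))" and ev: "is_eigenvalue_1d \<alpha> a \<xi>"
  shows "- (k\<^sup>2) \<le> \<xi>"
proof -
  obtain \<phi> g t where W: "W12_1d \<phi> g" and t: "\<phi> t \<noteq> 0"
    and eq: "\<And>\<eta> h. W12_1d \<eta> h \<Longrightarrow> (LINT t|lborel. g t * cnj (h t))
             - of_real \<alpha> * \<phi> a * cnj (\<eta> a) - of_real \<alpha> * \<phi> (-a) * cnj (\<eta> (-a))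
           = of_real \<xi> * (LINT t|lborel. \<phi> t * cnj (\<eta> t))"
    using ev unfolding is_eigenvalue_1d_def by blast
  define N where "N = (LINT x|lborel. (cmod (\<phi> x))\<^sup>2)"
  define G where "G = (LINT x|lborel. (cmod (g x))\<^sup>2)"
  have i: "integrable lborel (\<lambda>x. (cmod (g x))\<^sup>2)" "integrable lborel (\<lambda>x. k\<^sup>2 * (cmod (\<phi> x))\<^sup>2)"
    using W by (auto simp: W12_1d_iff_primitive)
  have sq: "(LINT t|lborel. u t * cnj (u t)) = of_real (LINT t|lborel. (cmod (u t))\<^sup>2)" for u :: "real \<Rightarrow> complex"
    by (simp add: complex_norm_square[symmetric] del: of_real_power)
  have "complex_of_real (G - \<alpha> * (cmod (\<phi> a))\<^sup>2 - \<alpha> * (cmod (\<phi> (-a)))\<^sup>2) = of_real (\<xi> * N)"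
    using eq[OF W] by (simp add: sq N_def G_def mult.assoc complex_norm_square del: of_real_power)
  then have E: "G - \<alpha> * (cmod (\<phi> a))\<^sup>2 - \<alpha> * (cmod (\<phi> (-a)))\<^sup>2 = \<xi> * N"
    by (simp only: of_real_eq_iff)
  have "k * (1 + tanh (k * (a - 0))) * (cmod (\<phi> a))\<^sup>2 + k * (1 - tanh (k * (-a - 0))) * (cmod (\<phi> (-a)))\<^sup>2
     \<le> (LINT x|lborel. (cmod (g x))\<^sup>2 + k\<^sup>2 * (cmod (\<phi> x))\<^sup>2)"
    using k a W i by (intro two_point_bound) (auto simp: W12_1d_iff_primitive)
  then have "\<alpha> * (cmod (\<phi> a))\<^sup>2 + \<alpha> * (cmod (\<phi> (-a)))\<^sup>2 \<le> G + k\<^sup>2 * N"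
    using i by (simp add: \<alpha> G_def N_def)
  with E have le: "- (k\<^sup>2) * N \<le> \<xi> * N" by simp
  have "N > 0"
  proof (rule ccontr)
    assume "\<not> N > 0"
    moreover have "N \<ge> 0" by (simp add: N_def)
    ultimately have N: "N = 0" by simp
    \<comment> \<open>If the norm were zero, this rate would make the left side of the pointwise
      bound equal to \<open>2 * (G + 1)\<close>, exceeding the right side \<open>G\<close>.\<close>
    define \<kappa> where "\<kappa> = (G + 1) / (cmod (\<phi> t))\<^sup>2"
    have "G \<ge> 0" by (simp add: G_def)
    then have \<kappa>: "\<kappa> > 0" using t by (simp add: \<kappa>_def add_nonneg_pos)
    have "2 * \<kappa> * (cmod (\<phi> t))\<^sup>2 \<le> G + \<kappa>\<^sup>2 * N"
      unfolding G_def N_def by (rule W12_1d_pointwise_bound[OF W \<kappa>])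
    then have "2 * (G + 1) \<le> G" using t N by (simp add: \<kappa>_def)
    then show False using \<open>G \<ge> 0\<close> by simp
  qed
  then show ?thesis using le by (simp only: mult_le_cancel_right_pos)
qed

text \<open>The value \<open>- (k\<^sup>2)\<close> is attained as an eigenvalue. The lower bound on
  all eigenvalues enters because \<open>Inf\<close> of a set of reals lies below its members only
  when the set is bounded below.\<close>

lemma xi0_le:
  assumes k: "k > 0" and a: "a > 0" and \<alpha>: "\<alpha> = k * (1 + tanh (k * a))"
  shows "xi0 \<alpha> a \<le> - (k\<^sup>2)"
  unfolding xi0_def
proof (rule cInf_lower)
  \<comment> \<open>Translates the tanh form of the secular equation into its exponential
    form.\<close>
  have "1 + tanh (k * a) = 2 / (1 + exp (- k * (2 * a)))"
    by (simp add: tanh_real_altdef field_simps add_pos_pos add_nonneg_eq_0_iff)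
  then have "\<alpha> * (1 + exp (- k * (2 * a))) = 2 * k"
    using add_pos_pos[OF zero_less_one exp_gt_zero[of "- k * (2 * a)"]] unfolding \<alpha> by simp
  then show "- (k\<^sup>2) \<in> {\<xi>. is_eigenvalue_1d \<alpha> a \<xi>}"
    using is_eigenvalue_1d_exp_kernel[OF k a] by simp
  show "bdd_below {\<xi>. is_eigenvalue_1d \<alpha> a \<xi>}"
    by (rule bdd_belowI[of _ "- (k\<^sup>2)"]) (use is_eigenvalue_1d_lower_bound[OF k a \<alpha>] in auto)
qed

text \<open>Intermediate value theorem on \<open>[0, \<alpha>]\<close>: the right side is 0 at
  \<open>k = 0\<close> and at least \<alpha> at \<open>k = \<alpha>\<close>.\<close>

lemma exists_ground_state_rate:
  assumes a: "a > 0" and \<alpha>: "\<alpha> > (0::real)"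
  shows "\<exists>k>0. \<alpha> = k * (1 + tanh (k * a))"
proof -
  have "\<exists>k\<ge>0. k \<le> \<alpha> \<and> k * (1 + tanh (k * a)) = \<alpha>"
  proof (rule IVT')
    show "\<alpha> \<le> \<alpha> * (1 + tanh (\<alpha> * a))" using a \<alpha> by simp
    show "continuous_on {0..\<alpha>} (\<lambda>k. k * (1 + tanh (k * a)))"
      by (intro continuous_intros) auto
  qed (use \<alpha> in auto)
  then obtain k where "k \<ge> 0" "k * (1 + tanh (k * a)) = \<alpha>" by auto
  moreover from this have "k \<noteq> 0" using \<alpha> by auto
  ultimately show ?thesis by (intro exI[of _ k]) auto
qed

subsection \<open>Fibres of functions on the plane\<close>

text \<open>Shifting the zero of the tanh-weight by \<open>b\<close> trades the slack \<open>V0\<close> at one interaction line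
  for a surplus at the other one, and the surplus pays for a smaller decay rate \<open>\<kappa>\<close>.\<close>
lemma exists_smaller_rate:
  fixes k a V0 :: real
  assumes k: "k > 0" and V0: "V0 > 0"
  shows "\<exists>\<kappa> b. 0 < \<kappa> \<and> \<kappa> < k \<and> k * (1 + tanh (k * a)) - V0 \<le> \<kappa> * (1 + tanh (\<kappa> * (a - b)))
    \<and> k * (1 + tanh (k * a)) \<le> \<kappa> * (1 + tanh (\<kappa> * (a + b)))"
proof -
  define \<alpha> where "\<alpha> = k * (1 + tanh (k * a))"
  have "((\<lambda>b. k * (1 + tanh (k * (a - b)))) \<longlongrightarrow> k * (1 + tanh (k * (a - 0)))) (at_right 0)"
    by (intro tendsto_intros) auto
  moreover have "\<alpha> - V0 < k * (1 + tanh (k * (a - 0)))" using V0 by (simp add: \<alpha>_def)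
  ultimately have "eventually (\<lambda>b. \<alpha> - V0 < k * (1 + tanh (k * (a - b)))) (at_right 0)"
    by (rule order_tendstoD)
  then have "eventually (\<lambda>b. 0 < b \<and> \<alpha> - V0 < k * (1 + tanh (k * (a - b)))) (at_right 0)"
    using eventually_at_right_less by eventually_elim auto
  then obtain b where b: "b > 0" "\<alpha> - V0 < k * (1 + tanh (k * (a - b)))"
    by (auto dest!: eventually_happens)
  have b2: "\<alpha> < k * (1 + tanh (k * (a + b)))"
    using k b by (simp add: \<alpha>_def)
  \<comment> \<open>At rate \<open>k\<close> both inequalities hold strictly, so by continuity they
    persist for rates slightly below \<open>k\<close>.\<close>
  have lim: "((\<lambda>\<kappa>. \<kappa> * (1 + tanh (\<kappa> * c))) \<longlongrightarrow> k * (1 + tanh (k * c))) (at_left k)" for c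
    by (intro tendsto_intros) auto
  have "eventually (\<lambda>\<kappa>. \<alpha> - V0 < \<kappa> * (1 + tanh (\<kappa> * (a - b)))) (at_left k)"
    "eventually (\<lambda>\<kappa>. \<alpha> < \<kappa> * (1 + tanh (\<kappa> * (a + b)))) (at_left k)"
    using order_tendstoD(1)[OF lim b(2)] order_tendstoD(1)[OF lim b2] by auto
  moreover have "eventually (\<lambda>\<kappa>. \<kappa> \<in> {0<..<k}) (at_left k)"
    using k by (rule eventually_at_left_real)
  ultimately have "eventually (\<lambda>\<kappa>. 0 < \<kappa> \<and> \<kappa> < k \<and> \<alpha> - V0 \<le> \<kappa> * (1 + tanh (\<kappa> * (a - b)))
    \<and> \<alpha> \<le> \<kappa> * (1 + tanh (\<kappa> * (a + b)))) (at_left k)"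
    by eventually_elim auto
  then show ?thesis unfolding \<alpha>_def by (auto dest!: eventually_happens)
qed

text \<open>The two-point bound at \<open>-a\<close> and \<open>a\<close>, where oddness of tanh
  turns the coefficient at \<open>-a\<close> into
  \<open>\<kappa> * (1 + tanh (\<kappa> * (a + b)))\<close>. A shift \<open>b > 0\<close> thus moves
  strength from \<open>a\<close> to \<open>-a\<close>.\<close>

lemma fibre_form_bound:
  assumes W: "W12_1d \<phi> g" and \<kappa>: "\<kappa> > 0" and a: "a > 0"
    and vp: "\<alpha> - vp \<le> \<kappa> * (1 + tanh (\<kappa> * (a - b)))" and vm: "\<alpha> - vm \<le> \<kappa> * (1 + tanh (\<kappa> * (a + b)))"
  shows "0 \<le> (LINT x|lborel. (cmod (g x))\<^sup>2) + \<kappa>\<^sup>2 * (LINT x|lborel. (cmod (\<phi> x))\<^sup>2)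
    + (vp - \<alpha>) * (cmod (\<phi> a))\<^sup>2 + (vm - \<alpha>) * (cmod (\<phi> (-a)))\<^sup>2"
proof -
  have i: "integrable lborel (\<lambda>x. (cmod (g x))\<^sup>2)" "integrable lborel (\<lambda>x. \<kappa>\<^sup>2 * (cmod (\<phi> x))\<^sup>2)"
    using W by (auto simp: W12_1d_iff_primitive)
  have "\<kappa> * (1 + tanh (\<kappa> * (a - b))) * (cmod (\<phi> a))\<^sup>2 + \<kappa> * (1 - tanh (\<kappa> * (- a - b))) * (cmod (\<phi> (-a)))\<^sup>2
     \<le> (LINT x|lborel. (cmod (g x))\<^sup>2 + \<kappa>\<^sup>2 * (cmod (\<phi> x))\<^sup>2)"
    using \<kappa> a W i by (intro two_point_bound) (auto simp: W12_1d_iff_primitive)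
  moreover have "\<kappa> * (- a - b) = - (\<kappa> * (a + b))" by (simp add: algebra_simps)
  then have "tanh (\<kappa> * (- a - b)) = - tanh (\<kappa> * (a + b))"
    by (simp only: tanh_minus)
  moreover have "(\<alpha> - vp) * (cmod (\<phi> a))\<^sup>2 \<le> \<kappa> * (1 + tanh (\<kappa> * (a - b))) * (cmod (\<phi> a))\<^sup>2"
    "(\<alpha> - vm) * (cmod (\<phi> (-a)))\<^sup>2 \<le> \<kappa> * (1 + tanh (\<kappa> * (a + b))) * (cmod (\<phi> (-a)))\<^sup>2"
    using vp vm by (auto intro: mult_right_mono)
  ultimately show ?thesis using i by (simp add: algebra_simps)
qed

lemma fibre_gap:
  assumes "W12_1d \<phi> g" "\<kappa> > 0" "\<kappa> < k" "a > 0" "\<alpha> = k * (1 + tanh (k * a))"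
    and b: "\<alpha> - V0 \<le> \<kappa> * (1 + tanh (\<kappa> * (a - b)))" "\<alpha> \<le> \<kappa> * (1 + tanh (\<kappa> * (a + b)))"
    and v: "vp \<ge> 0" "vm \<ge> 0" "P \<longrightarrow> vp \<ge> V0 \<or> vm \<ge> V0"
  shows "(k\<^sup>2 - \<kappa>\<^sup>2) * (of_bool P * (LINT x|lborel. (cmod (\<phi> x))\<^sup>2))
    \<le> (LINT x|lborel. (cmod (g x))\<^sup>2) + k\<^sup>2 * (LINT x|lborel. (cmod (\<phi> x))\<^sup>2)
    + (vp - \<alpha>) * (cmod (\<phi> a))\<^sup>2 + (vm - \<alpha>) * (cmod (\<phi> (-a)))\<^sup>2"
proof -
  consider "\<not> P" | "P" "vp \<ge> V0" | "P" "vm \<ge> V0" using v by blast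
  then show ?thesis
  proof cases
    case 1
    then show ?thesis using fibre_form_bound[of \<phi> g k a \<alpha> vp 0 vm] assms by simp
  next
    case 2
    then show ?thesis using fibre_form_bound[of \<phi> g \<kappa> a \<alpha> vp b vm] assms by (simp add: algebra_simps)
  next
    case 3
    then show ?thesis using fibre_form_bound[of \<phi> g \<kappa> a \<alpha> vp "-b" vm] assms by (simp add: algebra_simps)
  qed
qed

section \<open>Fubini's theorem and Sobolev sections\<close>

lemma borel_measurable_sections:
  assumes "f \<in> borel_measurable (lborel :: (real \<times> real) measure)"
  shows "(\<lambda>u. f (x, u)) \<in> borel_measurable lborel" "(\<lambda>u. f (u, x)) \<in> borel_measurable lborel"
proof -
  have [measurable]: "f \<in> borel_measurable (borel \<Otimes>\<^sub>M borel)"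
    using assms by (simp add: borel_prod)
  show "(\<lambda>u. f (x, u)) \<in> borel_measurable lborel" "(\<lambda>u. f (u, x)) \<in> borel_measurable lborel"
    by measurable
qed

lemma integral_sections:
  fixes f :: "real \<times> real \<Rightarrow> real"
  assumes "integrable lborel f"
  shows "AE x in lborel. integrable lborel (\<lambda>u. f (x, u))"
    and "integrable lborel (\<lambda>x. LINT u|lborel. f (x, u))"
    and "(LINT x|lborel. LINT u|lborel. f (x, u)) = integral\<^sup>L lborel f"
    and "AE x in lborel. integrable lborel (\<lambda>u. f (u, x))"
    and "integrable lborel (\<lambda>x. LINT u|lborel. f (u, x))"
    and "(LINT x|lborel. LINT u|lborel. f (u, x)) = integral\<^sup>L lborel f"
proof -
  have i: "integrable (lborel \<Otimes>\<^sub>M lborel) f" using assms by (simp add: lborel_prod)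
  then have j: "integrable (lborel \<Otimes>\<^sub>M lborel) (\<lambda>(x, y). f (x, y))" by simp
  show "AE x in lborel. integrable lborel (\<lambda>u. f (x, u))"
    using lborel_pair.AE_integrable_fst'[OF i] .
  show "integrable lborel (\<lambda>x. LINT u|lborel. f (x, u))"
    using lborel_pair.integrable_fst'[OF i] .
  show "(LINT x|lborel. LINT u|lborel. f (x, u)) = integral\<^sup>L lborel f"
    using lborel_pair.integral_fst'[OF i] by (simp add: lborel_prod)
  show "AE x in lborel. integrable lborel (\<lambda>u. f (u, x))"
    using lborel_pair.AE_integrable_snd[OF j] .
  show "integrable lborel (\<lambda>x. LINT u|lborel. f (u, x))"
    using lborel_pair.integrable_snd[OF j] .
  show "(LINT x|lborel. LINT u|lborel. f (u, x)) = integral\<^sup>L lborel f"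
    using lborel_pair.integral_snd[OF j] by (simp add: lborel_prod)
qed

text \<open>Fubini gives square integrability on almost every line, and the ACL clauses give
  absolute continuity there.\<close>

lemma W12_2d_sections:
  assumes "W12_2d \<psi> g1 g2"
  shows "AE x1 in lborel. W12_1d (\<lambda>u. \<psi> (x1, u)) (\<lambda>u. g2 (x1, u))"
    and "AE x2 in lborel. W12_1d (\<lambda>u. \<psi> (u, x2)) (\<lambda>u. g1 (u, x2))"
proof -
  have m: "\<psi> \<in> borel_measurable lborel" "g1 \<in> borel_measurable lborel" "g2 \<in> borel_measurable lborel"
    and i: "integrable lborel (\<lambda>x. (cmod (\<psi> x))\<^sup>2)"
     "integrable lborel (\<lambda>x. (cmod (g1 x))\<^sup>2)" "integrable lborel (\<lambda>x. (cmod (g2 x))\<^sup>2)"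
    and ac: "AE x2 in lborel. primitive (\<lambda>t. \<psi> (t, x2)) (\<lambda>u. g1 (u, x2))"
       "AE x1 in lborel. primitive (\<lambda>t. \<psi> (x1, t)) (\<lambda>u. g2 (x1, u))"
    using assms unfolding W12_2d_def primitive_def by auto
  note bm = borel_measurable_sections[OF m(1)] borel_measurable_sections[OF m(2)] borel_measurable_sections[OF m(3)]
  show "AE x1 in lborel. W12_1d (\<lambda>u. \<psi> (x1, u)) (\<lambda>u. g2 (x1, u))"
    using ac(2) integral_sections(1)[OF i(1)] integral_sections(1)[OF i(3)]
    by eventually_elim (use bm in \<open>auto simp: W12_1d_iff_primitive\<close>)
  show "AE x2 in lborel. W12_1d (\<lambda>u. \<psi> (u, x2)) (\<lambda>u. g1 (u, x2))"
    using ac(1) integral_sections(4)[OF i(1)] integral_sections(4)[OF i(2)]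
    by eventually_elim (use bm in \<open>auto simp: W12_1d_iff_primitive\<close>)
qed

text \<open>On almost every vertical line the pointwise bound with rate 1 controls the trace by the
  fibre norms, which are integrable in \<open>x1\<close>. As the Bochner integral of a
  non-integrable function is 0 by convention, this secures the meaning of the trace terms in
  \<open>form_E\<close>.\<close>

lemma W12_2d_trace_integrable:
  assumes W: "W12_2d \<psi> g1 g2"
    and V [measurable]: "V \<in> borel_measurable lborel" and B: "AE x in lborel. \<bar>V x\<bar> \<le> B"
  shows "integrable lborel (\<lambda>x1. (V x1 - \<alpha>) * (cmod (\<psi> (x1, p)))\<^sup>2)"
proof -
  have m: "\<psi> \<in> borel_measurable lborel"
    and i: "integrable lborel (\<lambda>x. (cmod (\<psi> x))\<^sup>2)" "integrable lborel (\<lambda>x. (cmod (g2 x))\<^sup>2)"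
    using W unfolding W12_2d_def by auto
  note [measurable] = borel_measurable_sections(2)[OF m]
  let ?M = "\<lambda>x1. (LINT u|lborel. (cmod (g2 (x1, u)))\<^sup>2) + (LINT u|lborel. (cmod (\<psi> (x1, u)))\<^sup>2)"
  show ?thesis
  proof (rule Bochner_Integration.integrable_bound)
    show "integrable lborel (\<lambda>x1. (B + \<bar>\<alpha>\<bar>) * ?M x1)"
      using i by (intro integrable_mult_right Bochner_Integration.integrable_add integral_sections(2))
    show "AE x1 in lborel. norm ((V x1 - \<alpha>) * (cmod (\<psi> (x1, p)))\<^sup>2) \<le> norm ((B + \<bar>\<alpha>\<bar>) * ?M x1)"
      using B W12_2d_sections(1)[OF W]
    proof eventually_elim
      case (elim x1)
      have "2 * (cmod (\<psi> (x1, p)))\<^sup>2 \<le> ?M x1"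
        using W12_1d_pointwise_bound[OF elim(2), of 1 p] by simp
      then have "(cmod (\<psi> (x1, p)))\<^sup>2 \<le> ?M x1"
        using zero_le_power2[of "cmod (\<psi> (x1, p))"] by linarith
      moreover have "\<bar>V x1 - \<alpha>\<bar> \<le> B + \<bar>\<alpha>\<bar>" using elim(1) by linarith
      ultimately have "\<bar>V x1 - \<alpha>\<bar> * (cmod (\<psi> (x1, p)))\<^sup>2 \<le> (B + \<bar>\<alpha>\<bar>) * ?M x1"
        by (intro mult_mono) auto
      moreover have "\<bar>B + \<bar>\<alpha>\<bar>\<bar> = B + \<bar>\<alpha>\<bar>" using elim(1) by linarith
      ultimately show ?case by (simp add: abs_mult)
    qed
  qed measurable
qed

section \<open>Combination of the vertical and horizontal estimates\<close>

theorem theorem5p2: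
  fixes a \<alpha> V0 R :: real
  assumes "a > 0" and "\<alpha> > 0" and "V0 > 0" and "R > 0"
  shows "\<exists>c>0. \<forall>(Vp :: real \<Rightarrow> real) (Vm :: real \<Rightarrow> real) (x10 :: real).
     Vp \<in> borel_measurable lborel \<and> Vm \<in> borel_measurable lborel \<and>
     (\<exists>B. AE x in lborel. \<bar>Vp x\<bar> \<le> B) \<and> (\<exists>B. AE x in lborel. \<bar>Vm x\<bar> \<le> B) \<and>
     (AE x in lborel. Vp x \<ge> 0) \<and> (AE x in lborel. Vm x \<ge> 0) \<and>
     (AE x1 in lborel. x1 \<in> {x10 - R<..<x10 + R} \<longrightarrow> Vp x1 \<ge> V0 \<or> Vm x1 \<ge> V0)
     \<longrightarrow> (\<forall>\<psi> g1 g2. W12_2d \<psi> g1 g2 \<longrightarrow>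
           form_E \<alpha> a Vp Vm \<psi> g1 g2 - xi0 \<alpha> a * (LINT x|lborel. (cmod (\<psi> x))\<^sup>2)
             \<ge> c * (LINT x|lborel. (1 / (1 + (fst x - x10)\<^sup>2)) * (cmod (\<psi> x))\<^sup>2))"
proof -
  obtain k where k: "k > 0" and \<alpha>: "\<alpha> = k * (1 + tanh (k * a))"
    using exists_ground_state_rate[OF assms(1,2)] by blast
  obtain \<kappa> b where \<kappa>: "0 < \<kappa>" "\<kappa> < k" and b: "\<alpha> - V0 \<le> \<kappa> * (1 + tanh (\<kappa> * (a - b)))"
      "\<alpha> \<le> \<kappa> * (1 + tanh (\<kappa> * (a + b)))"
    using exists_smaller_rate[OF k assms(3), of a] unfolding \<alpha> by blast
  \<comment> \<open>The spectral gap on fibres where a potential is at least \<open>V0\<close>. It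
    is determined by \<alpha>, \<open>a\<close> and \<open>V0\<close> before any potential is fixed,
    so the Hardy constant \<open>c\<close> obtained from it and \<open>R\<close> is uniform.\<close>
  define \<mu> where "\<mu> = k\<^sup>2 - \<kappa>\<^sup>2"
  have "\<mu> > 0" using \<kappa> by (simp add: \<mu>_def power_strict_mono)
  from hardy_inequality[OF assms(4) this] obtain c where c: "c > 0"
    and hardy: "\<And>y \<phi> g. W12_1d \<phi> g \<Longrightarrow>
       c * (LINT x|lborel. 1 / (1 + (x - y)\<^sup>2) * (cmod (\<phi> x))\<^sup>2)
       \<le> (LINT x|lborel. (cmod (g x))\<^sup>2) + \<mu> * (LINT x|lborel. indicator {y - R<..<y + R} x * (cmod (\<phi> x))\<^sup>2)"
    unfolding W12_1d_iff_primitive by blast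
  show ?thesis
  proof (intro exI[of _ c] conjI c allI impI, elim conjE exE)
    fix Vp Vm x10 \<psi> g1 g2 Bp Bm
    assume W: "W12_2d \<psi> g1 g2"
      and Vp: "Vp \<in> borel_measurable lborel" "AE x in lborel. \<bar>Vp x\<bar> \<le> Bp" "AE x in lborel. Vp x \<ge> 0"
      and Vm: "Vm \<in> borel_measurable lborel" "AE x in lborel. \<bar>Vm x\<bar> \<le> Bm" "AE x in lborel. Vm x \<ge> 0"
      and V: "AE x1 in lborel. x1 \<in> {x10 - R<..<x10 + R} \<longrightarrow> Vp x1 \<ge> V0 \<or> Vm x1 \<ge> V0"
    define I where "I = {x10 - R<..<x10 + R}"
    define \<rho> where "\<rho> = (\<lambda>x. 1 / (1 + (x - x10)\<^sup>2))"
    have i: "integrable lborel (\<lambda>x. (cmod (\<psi> x))\<^sup>2)"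
      and i1: "integrable lborel (\<lambda>x. (cmod (g1 x))\<^sup>2)" and i2: "integrable lborel (\<lambda>x. (cmod (g2 x))\<^sup>2)"
      using W unfolding W12_2d_def by auto
    have [measurable]: "(\<lambda>x. (cmod (\<psi> x))\<^sup>2) \<in> borel_measurable borel" using i by auto
    have iI: "integrable lborel (\<lambda>x. indicator I (fst x) * (cmod (\<psi> x))\<^sup>2)"
    proof (rule Bochner_Integration.integrable_bound[OF i])
      have "(\<lambda>x. indicator I (fst x) :: real) \<in> borel_measurable (borel :: (real \<times> real) measure)"
        unfolding I_def by (simp add: borel_prod[symmetric])
      then show "(\<lambda>x. indicator I (fst x) * (cmod (\<psi> x))\<^sup>2) \<in> borel_measurable lborel"
        by simp
    qed (auto simp: indicator_def)
    have i\<rho>: "integrable lborel (\<lambda>x. \<rho> (fst x) * (cmod (\<psi> x))\<^sup>2)"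
    proof (rule Bochner_Integration.integrable_bound[OF i])
      have "(\<lambda>x. \<rho> (fst x)) \<in> borel_measurable (borel :: (real \<times> real) measure)"
        unfolding \<rho>_def by (simp add: borel_prod[symmetric])
      then show "(\<lambda>x. \<rho> (fst x) * (cmod (\<psi> x))\<^sup>2) \<in> borel_measurable lborel"
        by simp
      have "\<bar>\<rho> x\<bar> \<le> 1" for x by (simp add: \<rho>_def add_pos_nonneg)
      then show "AE x in lborel. norm (\<rho> (fst x) * (cmod (\<psi> x))\<^sup>2) \<le> norm ((cmod (\<psi> x))\<^sup>2)"
        by (simp add: abs_mult mult_left_le_one_le)
    qed
    define N where "N = (\<lambda>x1. LINT u|lborel. (cmod (\<psi> (x1, u)))\<^sup>2)"
    define G where "G = (\<lambda>x1. LINT u|lborel. (cmod (g2 (x1, u)))\<^sup>2)"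
    define tp where "tp = (\<lambda>x1. (Vp x1 - \<alpha>) * (cmod (\<psi> (x1, a)))\<^sup>2)"
    define tm where "tm = (\<lambda>x1. (Vm x1 - \<alpha>) * (cmod (\<psi> (x1, -a)))\<^sup>2)"
    have iN: "integrable lborel N" and iG: "integrable lborel G"
      and itp: "integrable lborel tp" and itm: "integrable lborel tm"
      unfolding N_def G_def tp_def tm_def
      using i i2 integral_sections(2) W12_2d_trace_integrable[OF W Vp(1,2)] W12_2d_trace_integrable[OF W Vm(1,2)]
      by auto
    \<comment> \<open>Integrates \<open>fibre_gap\<close> over \<open>x1\<close>; the surplus is
      \<mu> times the mass of \<psi> over the strip above \<open>I\<close>.\<close>
    have vertical: "\<mu> * (LINT x|lborel. indicator I (fst x) * (cmod (\<psi> x))\<^sup>2)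
        \<le> (LINT x|lborel. (cmod (g2 x))\<^sup>2) + k\<^sup>2 * (LINT x|lborel. (cmod (\<psi> x))\<^sup>2)
          + integral\<^sup>L lborel tp + integral\<^sup>L lborel tm"
    proof -
      have "\<mu> * (LINT x|lborel. indicator I (fst x) * (cmod (\<psi> x))\<^sup>2) = (LINT x1|lborel. \<mu> * (indicator I x1 * N x1))"
        using integral_sections(3)[OF iI] by (simp add: N_def)
      also have "\<dots> \<le> (LINT x1|lborel. G x1 + k\<^sup>2 * N x1 + tp x1 + tm x1)"
      proof (rule integral_mono_AE)
        show "integrable lborel (\<lambda>x1. \<mu> * (indicator I x1 * N x1))"
          using integrable_mult_indicator[OF _ iN, of I] by (simp add: I_def)
        show "integrable lborel (\<lambda>x1. G x1 + k\<^sup>2 * N x1 + tp x1 + tm x1)"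
          using iG iN itp itm by simp
        show "AE x1 in lborel. \<mu> * (indicator I x1 * N x1) \<le> G x1 + k\<^sup>2 * N x1 + tp x1 + tm x1"
          using W12_2d_sections(1)[OF W] Vp(3) Vm(3) V
        proof eventually_elim
          case (elim x1)
          show ?case
            using fibre_gap[OF elim(1) \<kappa> assms(1) \<alpha> b elim(2,3,4)]
            by (simp add: \<mu>_def I_def N_def G_def tp_def tm_def indicator_def)
        qed
      qed
      also have "\<dots> = integral\<^sup>L lborel G + k\<^sup>2 * integral\<^sup>L lborel N + integral\<^sup>L lborel tp + integral\<^sup>L lborel tm"
        using iG iN itp itm by simp
      finally show ?thesis
        unfolding N_def G_def integral_sections(3)[OF i] integral_sections(3)[OF i2] .
    qed
    \<comment> \<open>Hardy's inequality on each horizontal line consumes exactly the strip term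
      gained from the vertical direction.\<close>
    have horizontal: "c * (LINT x|lborel. \<rho> (fst x) * (cmod (\<psi> x))\<^sup>2)
        \<le> (LINT x|lborel. (cmod (g1 x))\<^sup>2) + \<mu> * (LINT x|lborel. indicator I (fst x) * (cmod (\<psi> x))\<^sup>2)"
    proof -
      note j\<rho> = integral_sections(5)[OF i\<rho>] and j1 = integral_sections(5)[OF i1] and jI = integral_sections(5)[OF iI]
      have "(LINT x2|lborel. c * (LINT u|lborel. \<rho> (fst (u, x2)) * (cmod (\<psi> (u, x2)))\<^sup>2))
          \<le> (LINT x2|lborel. (LINT u|lborel. (cmod (g1 (u, x2)))\<^sup>2)
              + \<mu> * (LINT u|lborel. indicator I (fst (u, x2)) * (cmod (\<psi> (u, x2)))\<^sup>2))"
      proof (rule integral_mono_AE)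
        show "AE x2 in lborel. c * (LINT u|lborel. \<rho> (fst (u, x2)) * (cmod (\<psi> (u, x2)))\<^sup>2)
            \<le> (LINT u|lborel. (cmod (g1 (u, x2)))\<^sup>2)
              + \<mu> * (LINT u|lborel. indicator I (fst (u, x2)) * (cmod (\<psi> (u, x2)))\<^sup>2)"
          using W12_2d_sections(2)[OF W]
          by eventually_elim (use hardy[where y = x10] in \<open>simp add: \<rho>_def I_def\<close>)
      qed (intro integrable_mult_right Bochner_Integration.integrable_add j\<rho> j1 jI)+
      then show ?thesis
        unfolding Bochner_Integration.integral_add[OF j1 integrable_mult_right[OF jI]] integral_mult_right_zero
          integral_sections(6)[OF i\<rho>] integral_sections(6)[OF i1] integral_sections(6)[OF iI] .
    qed
    have "xi0 \<alpha> a * (LINT x|lborel. (cmod (\<psi> x))\<^sup>2) \<le> - (k\<^sup>2) * (LINT x|lborel. (cmod (\<psi> x))\<^sup>2)"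
      by (intro mult_right_mono xi0_le k assms(1) \<alpha>) simp
    moreover have "form_E \<alpha> a Vp Vm \<psi> g1 g2 = (LINT x|lborel. (cmod (g1 x))\<^sup>2) + (LINT x|lborel. (cmod (g2 x))\<^sup>2)
        + integral\<^sup>L lborel tp + integral\<^sup>L lborel tm"
      unfolding form_E_def tp_def tm_def using i1 i2 by simp
    ultimately have "c * (LINT x|lborel. \<rho> (fst x) * (cmod (\<psi> x))\<^sup>2)
        \<le> form_E \<alpha> a Vp Vm \<psi> g1 g2 - xi0 \<alpha> a * (LINT x|lborel. (cmod (\<psi> x))\<^sup>2)"
      using vertical horizontal by linarith
    then show "c * (LINT x|lborel. (1 / (1 + (fst x - x10)\<^sup>2)) * (cmod (\<psi> x))\<^sup>2)
        \<le> form_E \<alpha> a Vp Vm \<psi> g1 g2 - xi0 \<alpha> a * (LINT x|lborel. (cmod (\<psi> x))\<^sup>2)"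
      by (simp only: \<rho>_def)
  qed
qed

end
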